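(* Let $\gamma$ be a translation-invariant (nonnull) specification, $\nu\in\mathcal G_{\mathrm{inv}}(\gamma)$, and $\mu\in\mathcal M^+_{1,\mathrm{inv}}$ satisfying Condition C1: $\mu(\Omega^{\le 0}_\gamma)=1$. Then: (1) $h(\mu|\nu)$ exists if and only if $e^+_\nu$ exists, and in that case $$h(\mu|\nu)=-h(\mu)+e^+_\nu-\int_\Omega\log\frac{\gamma_0(\sigma^+|\sigma^+)}{\gamma_0(+|\sigma^+)}\,\mu(d\sigma).$$ (2) If moreover $\mu\in\mathcal G_{\mathrm{inv}}(\gamma)$ and $e^+_\nu$ exists, then the limit $\lim_{n\to\infty}\frac1{|\Lambda_n|}\log\frac{\mu(+_{\Lambda_n})}{\nu(+_{\Lambda_n})}$ exists and equals $h(\mu|\nu)$.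
   Context: Let $E$ be a finite set containing a distinguished element denoted $+1$, and $\Omega=E^{\mathbb Z^d}$ with product topology and Borel $\sigma$-field $\mathcal F$; $\mathcal F_\Lambda$ is the $\sigma$-field of the coordinates in $\Lambda$, $\mathcal S$ the finite subsets of $\mathbb Z^d$, $\sigma_\Lambda\omega_{\Lambda^c}$ the configuration equal to $\sigma$ on $\Lambda$ and $\omega$ off $\Lambda$, and $\mu(\sigma_\Lambda)=\mu(\{\omega:\omega_\Lambda=\sigma_\Lambda\})$. Local functions are $\mathcal F_\Delta$-measurable for some finite $\Delta$. Translations $(\tau_x\omega)(y)=\omega(x+y)$; $\mathcal M^+_{1,\mathrm{inv}}$ = translation-invariant probability measures. A specification $\gamma=(\gamma_\Lambda)_{\Lambda\in\mathcal S}$ is a family of probability kernels $\gamma_\Lambda(\cdot|\omega)$, $\mathcal F_{\Lambda^c}$-measurable in $\omega$, proper ($\gamma_\Lambda(B|\omega)=1_B(\omega)$ for $B\in\mathcal F_{\Lambda^c}$) and consistent ($\int\gamma_\Lambda(A|\omega')\gamma_{\Lambda'}(d\omega'|\omega)=\gamma_{\Lambda'}(A|\omega)$ for $\Lambda\subset\Lambda'$, every $\omega$); it is nonnull: $0<a_\Lambda<\inf_{\sigma,\eta}\gamma_\Lambda(\sigma_\Lambda|\eta)\le\sup_{\sigma,\eta}\gamma_\Lambda(\sigma_\Lambda|\eta)<b_\Lambda<1$, where $\gamma_\Lambda(\sigma_\Lambda|\eta)=\gamma_\Lambda(\{\omega:\omega_\Lambda=\sigma_\Lambda\}|\eta)$;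 translation-invariant means $\gamma_{\Lambda+x}(A|\omega)=\gamma_\Lambda(\tau_xA|\tau_x\omega)$. $\mathcal G(\gamma)$ is the set of probability measures $\mu$ with $\mu(A|\mathcal F_{\Lambda^c})=\gamma_\Lambda(A|\cdot)$ $\mu$-a.s. for all $\Lambda,A$; $\mathcal G_{\mathrm{inv}}(\gamma)=\mathcal G(\gamma)\cap\mathcal M^+_{1,\mathrm{inv}}$. $\omega$ is a point of continuity of $\gamma$ if $\omega'\mapsto\int f\,d\gamma_\Lambda(\cdot|\omega')$ is continuous at $\omega$ for all $\Lambda\in\mathcal S$ and local $f$; $\Omega_\gamma$ is the set of such points. Let $+$ denote the configuration identically $+1$, and $+_\Lambda$ its restriction to $\Lambda$. With $\le$ the lexicographic order on $\mathbb Z^d$, for $\sigma\in\Omega$ let $\sigma^+(x)=\sigma(x)$ if $x\le 0$ and $\sigma^+(x)=+1$ if $x>0$; $\Omega^{\le0}_\gamma=\{\sigma\in\Omega:\sigma^+\in\Omega_\gamma\}$. For $a\in E$ write $\gamma_0(a|\omega)=\gamma_{\{0\}}(\{\omega':\omega'(0)=a\}|\omega)$, and for configurations $\gamma_0(\sigma|\omega)=\gamma_0(\sigma(0)|\omega)$. Let $\Lambda_n=[-n,n]^d\cap\mathbb Z^d$. The $\nu$-specific energy of the plus state is $e^+_\nu=-\lim_{n\to\infty}|\Lambda_n|^{-1}\log\nu(+_{\Lambda_n})$ whenever the limit exists. Relative entropy: $h_\Lambda(\mu|\nu)=\sum_{\sigma_\Lambda}\mu(\sigma_\Lambda)\log\frac{\mu(\sigma_\Lambda)}{\nu(\sigma_\Lambda)}$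 and $h(\mu|\nu)=\lim_n|\Lambda_n|^{-1}h_{\Lambda_n}(\mu|\nu)$ when it exists. Kolmogorov–Sinai entropy: $h(\mu)=-\lim_n|\Lambda_n|^{-1}\sum_{\sigma_{\Lambda_n}}\mu(\sigma_{\Lambda_n})\log\mu(\sigma_{\Lambda_n})$. *)

theory Defs
  imports "HOL-Probability.Probability"
begin

text \<open>Sites are elements of Z^d, rendered as int ^ 'd for a finite linearly ordered
index type 'd (d = CARD('d)); configurations are functions from sites to a finite
spin set 'e.\<close>

definition Omega :: "(int ^ 'd \<Rightarrow> 'e) measure" where
  "Omega = PiM UNIV (\<lambda>_. count_space UNIV)"

definition Fsig :: "(int ^ 'd) set \<Rightarrow> (int ^ 'd \<Rightarrow> 'e) measure" where
  "Fsig L = sigma UNIV {{\<omega>. \<omega> x = a} | x a. x \<in> L}"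

definition Ptop :: "(int ^ 'd \<Rightarrow> 'e) topology" where
  "Ptop = product_topology (\<lambda>_. discrete_topology UNIV) UNIV"

definition cyl :: "(int ^ 'd) set \<Rightarrow> (int ^ 'd \<Rightarrow> 'e) \<Rightarrow> (int ^ 'd \<Rightarrow> 'e) set" where
  "cyl L \<sigma> = {\<omega>. \<forall>x\<in>L. \<omega> x = \<sigma> x}"

definition cfgs :: "(int ^ 'd) set \<Rightarrow> (int ^ 'd \<Rightarrow> 'e) set" where
  "cfgs L = PiE L (\<lambda>_. UNIV)"

definition shift :: "int ^ 'd \<Rightarrow> (int ^ 'd \<Rightarrow> 'e) \<Rightarrow> (int ^ 'd \<Rightarrow> 'e)" where
  "shift x \<omega> = (\<lambda>y. \<omega> (x + y))"

definition lex_le where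
  "lex_le (x :: int ^ ('d::{finite,linorder})) y \<longleftrightarrow> x = y \<or> (\<exists>i. x $ i < y $ i \<and> (\<forall>j<i. x $ j = y $ j))"

definition plus_ext where
  "plus_ext (pl :: 'e) (\<sigma> :: int ^ ('d::{finite,linorder}) \<Rightarrow> 'e) = (\<lambda>x. if lex_le x 0 then \<sigma> x else pl)"

definition box :: "nat \<Rightarrow> (int ^ 'd) set" where
  "box n = {x. \<forall>i. \<bar>x $ i\<bar> \<le> int n}"

definition is_prob :: "(int ^ 'd \<Rightarrow> 'e) measure \<Rightarrow> bool" where
  "is_prob \<mu> \<longleftrightarrow> prob_space \<mu> \<and> sets \<mu> = sets Omega"


definition is_specification :: "((int ^ 'd) set \<Rightarrow> (int ^ 'd \<Rightarrow> 'e) \<Rightarrow> (int ^ 'd \<Rightarrow> 'e) measure) \<Rightarrow> bool" where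
  "is_specification \<gamma> \<longleftrightarrow> (\<forall>L. finite L \<longrightarrow>
     (\<forall>\<omega>. is_prob (\<gamma> L \<omega>)) \<and>
     (\<forall>A\<in>sets Omega. (\<lambda>\<omega>. measure (\<gamma> L \<omega>) A) \<in> borel_measurable (Fsig (- L))) \<and>
     (\<forall>B\<in>sets (Fsig (- L)). \<forall>\<omega>. measure (\<gamma> L \<omega>) B = indicator B \<omega>) \<and>
     (\<forall>L'. finite L' \<and> L \<subseteq> L' \<longrightarrow> (\<forall>A\<in>sets Omega. \<forall>\<omega>.
        (\<integral>\<omega>'. measure (\<gamma> L \<omega>') A \<partial>(\<gamma> L' \<omega>)) = measure (\<gamma> L' \<omega>) A)))"

definition nonnull :: "((int ^ 'd) set \<Rightarrow> (int ^ 'd \<Rightarrow> 'e) \<Rightarrow> (int ^ 'd \<Rightarrow> 'e) measure) \<Rightarrow> bool" where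
  "nonnull \<gamma> \<longleftrightarrow> (\<forall>L. finite L \<and> L \<noteq> {} \<longrightarrow> (\<exists>a b. 0 < a \<and> b < 1 \<and>
     (\<forall>\<sigma> \<eta>. a < measure (\<gamma> L \<eta>) (cyl L \<sigma>) \<and> measure (\<gamma> L \<eta>) (cyl L \<sigma>) < b)))"

definition trans_inv_spec :: "((int ^ 'd) set \<Rightarrow> (int ^ 'd \<Rightarrow> 'e) \<Rightarrow> (int ^ 'd \<Rightarrow> 'e) measure) \<Rightarrow> bool" where
  "trans_inv_spec \<gamma> \<longleftrightarrow> (\<forall>L x A \<omega>. finite L \<longrightarrow> A \<in> sets Omega \<longrightarrow>
     measure (\<gamma> ((\<lambda>y. y + x) ` L) \<omega>) A = measure (\<gamma> L (shift x \<omega>)) (shift x ` A))"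

definition inv_measure :: "(int ^ 'd \<Rightarrow> 'e) measure \<Rightarrow> bool" where
  "inv_measure \<mu> \<longleftrightarrow> is_prob \<mu> \<and>
     (\<forall>x. \<forall>A\<in>sets Omega. measure \<mu> (shift x -` A) = measure \<mu> A)"

text \<open>Gibbs measures (DLR equations, written via the defining property of conditional probability)\<close>
definition Gibbs :: "((int ^ 'd) set \<Rightarrow> (int ^ 'd \<Rightarrow> 'e) \<Rightarrow> (int ^ 'd \<Rightarrow> 'e) measure) \<Rightarrow> (int ^ 'd \<Rightarrow> 'e) measure \<Rightarrow> bool" where
  "Gibbs \<gamma> \<mu> \<longleftrightarrow> is_prob \<mu> \<and> (\<forall>L. finite L \<longrightarrow>
     (\<forall>A\<in>sets Omega. \<forall>B\<in>sets (Fsig (- L)).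
        measure \<mu> (A \<inter> B) = set_lebesgue_integral \<mu> B (\<lambda>\<omega>. measure (\<gamma> L \<omega>) A)))"

definition Gibbs_inv :: "((int ^ 'd) set \<Rightarrow> (int ^ 'd \<Rightarrow> 'e) \<Rightarrow> (int ^ 'd \<Rightarrow> 'e) measure) \<Rightarrow> (int ^ 'd \<Rightarrow> 'e) measure \<Rightarrow> bool" where
  "Gibbs_inv \<gamma> \<mu> \<longleftrightarrow> Gibbs \<gamma> \<mu> \<and> inv_measure \<mu>"

definition local_fn :: "((int ^ 'd \<Rightarrow> 'e) \<Rightarrow> real) \<Rightarrow> bool" where
  "local_fn f \<longleftrightarrow> (\<exists>D. finite D \<and> f \<in> borel_measurable (Fsig D))"

definition cont_point :: "((int ^ 'd) set \<Rightarrow> (int ^ 'd \<Rightarrow> 'e) \<Rightarrow> (int ^ 'd \<Rightarrow> 'e) measure) \<Rightarrow> (int ^ 'd \<Rightarrow> 'e) \<Rightarrow> bool" where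
  "cont_point \<gamma> \<omega> \<longleftrightarrow> (\<forall>L f. finite L \<longrightarrow> local_fn f \<longrightarrow>
     (\<forall>e>0. \<exists>U. openin Ptop U \<and> \<omega> \<in> U \<and>
        (\<forall>\<omega>'\<in>U. \<bar>(\<integral>\<xi>. f \<xi> \<partial>(\<gamma> L \<omega>')) - (\<integral>\<xi>. f \<xi> \<partial>(\<gamma> L \<omega>))\<bar> < e)))"

definition Omega_le0 where
  "Omega_le0 (pl :: 'e) \<gamma> = {\<sigma> :: int ^ ('d::{finite,linorder}) \<Rightarrow> 'e. cont_point \<gamma> (plus_ext pl \<sigma>)}"

definition gamma0 :: "((int ^ 'd) set \<Rightarrow> (int ^ 'd \<Rightarrow> 'e) \<Rightarrow> (int ^ 'd \<Rightarrow> 'e) measure) \<Rightarrow> 'e \<Rightarrow> (int ^ 'd \<Rightarrow> 'e) \<Rightarrow> real" where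
  "gamma0 \<gamma> a \<omega> = measure (\<gamma> {0} \<omega>) {\<omega>'. \<omega>' 0 = a}"

definition rel_ent_box :: "(int ^ 'd \<Rightarrow> 'e) measure \<Rightarrow> (int ^ 'd \<Rightarrow> 'e) measure \<Rightarrow> (int ^ 'd) set \<Rightarrow> real" where
  "rel_ent_box \<mu> \<nu> L = (\<Sum>\<sigma>\<in>cfgs L. measure \<mu> (cyl L \<sigma>) * ln (measure \<mu> (cyl L \<sigma>) / measure \<nu> (cyl L \<sigma>)))"

definition ent_box :: "(int ^ 'd \<Rightarrow> 'e) measure \<Rightarrow> (int ^ 'd) set \<Rightarrow> real" where
  "ent_box \<mu> L = - (\<Sum>\<sigma>\<in>cfgs L. measure \<mu> (cyl L \<sigma>) * ln (measure \<mu> (cyl L \<sigma>)))"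

text \<open>the sequences whose limits define h(mu|nu), h(mu), e^+_nu\<close>
definition rel_ent_seq :: "(int ^ 'd \<Rightarrow> 'e) measure \<Rightarrow> (int ^ 'd \<Rightarrow> 'e) measure \<Rightarrow> nat \<Rightarrow> real" where
  "rel_ent_seq \<mu> \<nu> n = rel_ent_box \<mu> \<nu> (box n) / real (card (box n :: (int ^ 'd) set))"

definition ent_seq :: "(int ^ 'd \<Rightarrow> 'e) measure \<Rightarrow> nat \<Rightarrow> real" where
  "ent_seq \<mu> n = ent_box \<mu> (box n) / real (card (box n :: (int ^ 'd) set))"

definition eplus_seq :: "'e \<Rightarrow> (int ^ 'd \<Rightarrow> 'e) measure \<Rightarrow> nat \<Rightarrow> real" where
  "eplus_seq pl \<nu> n = - ln (measure \<nu> (cyl (box n) (\<lambda>_. pl))) / real (card (box n :: (int ^ 'd) set))"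

end

theory Submission
  imports Defs "HOL-Real_Asymp.Real_Asymp"
begin

text \<open>The relative entropy in a box is the sum of minus the entropy of \<open>\<mu>\<close>, minus the
  \<open>\<mu>\<close>-expectation of \<open>ln (\<nu>(\<sigma>) / \<nu>(+))\<close>, and \<open>- ln \<nu>(+)\<close>. The second term is telescoped by
  changing \<open>+\<close> into \<open>\<sigma>\<close> one site at a time along the lexicographic order. By the DLR equations each
  step is a ratio of averages of single-site kernels over configurations that agree, within the box,
  with \<open>\<sigma>\<close> up to the current site and with \<open>+\<close> beyond it. Condition C1 together with translation
  invariance makes this ratio close in \<open>\<mu>\<close>-mean to the integrand of the theorem, except at
  sites near the boundary, whose contribution is of lower order by nonnullness. The entropy itself
  converges by the same telescoping, because conditional entropies decrease as the past grows. If
  \<open>\<mu>\<close> is Gibbs too, the second term has the same limit with \<open>\<mu>\<close> in place of \<open>\<nu>\<close>, and subtracting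
  gives the last claim.\<close>

section \<open>Local functions and cylinder events\<close>

text \<open>Locality is a pointwise condition with values in any type, so that it also covers
  predicates such as membership in an event. It is checked by showing that two cylinders coincide,
  without any reference to \<open>Fsig\<close>.\<close>

definition determined_by :: "'a set \<Rightarrow> (('a \<Rightarrow> 'b) \<Rightarrow> 'c) \<Rightarrow> bool" where
  "determined_by L f \<longleftrightarrow> (\<forall>\<omega> \<omega>'. (\<forall>x\<in>L. \<omega> x = \<omega>' x) \<longrightarrow> f \<omega> = f \<omega>')"

lemma determined_byI: "(\<And>\<omega> \<omega>'. (\<And>x. x \<in> L \<Longrightarrow> \<omega> x = \<omega>' x) \<Longrightarrow> f \<omega> = f \<omega>') \<Longrightarrow> determined_by L f"
  unfolding determined_by_def by blast

lemma determined_byD: "determined_by L f \<Longrightarrow> (\<And>x. x \<in> L \<Longrightarrow> \<omega> x = \<omega>' x) \<Longrightarrow> f \<omega> = f \<omega>'"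
  unfolding determined_by_def by blast

lemma space_Omega [simp]: "space Omega = UNIV"
  by (simp add: Omega_def space_PiM)

lemma space_Fsig [simp]: "space (Fsig L) = UNIV"
  by (simp add: Fsig_def space_measure_of_conv)

lemma sets_Fsig: "sets (Fsig L) = sigma_sets UNIV {{\<omega>. \<omega> x = a} | x a. x \<in> L}"
  by (simp add: Fsig_def)

lemma measurable_coordinate [measurable]: "(\<lambda>\<omega>. \<omega> x) \<in> Omega \<rightarrow>\<^sub>M count_space UNIV"
  unfolding Omega_def by measurable

lemma coordinate_in_sets_Omega: "{\<omega>. \<omega> x = a} \<in> sets Omega"
proof -
  have "(\<lambda>\<omega>. \<omega> x) -` {a} \<inter> space Omega \<in> sets Omega"
    by (rule measurable_sets[OF measurable_coordinate]) simp
  then show ?thesis by (simp add: vimage_def)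
qed

lemma sets_Fsig_subset: "sets (Fsig L) \<subseteq> sets Omega"
  unfolding sets_Fsig using coordinate_in_sets_Omega
  by (intro sets.sigma_sets_subset[where M = Omega, simplified]) auto

lemma cyl_insert: "cyl (insert x L) \<sigma> = {\<omega>. \<omega> x = \<sigma> x} \<inter> cyl L \<sigma>"
  by (auto simp: cyl_def)

lemma cyl_in_sets_Fsig:
  assumes "finite D" "D \<subseteq> L"
  shows "cyl D \<sigma> \<in> sets (Fsig L)"
  using assms
proof (induction D)
  case empty
  then show ?case using sets.top[of "Fsig L"] by (simp add: cyl_def)
next
  case (insert x D)
  have "{\<omega>. \<omega> x = \<sigma> x} \<in> sets (Fsig L)"
    unfolding sets_Fsig using insert.prems by (intro sigma_sets.Basic) auto
  with insert show ?case by (auto simp: cyl_insert)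
qed

lemma cyl_in_sets_Omega [simp]: "finite D \<Longrightarrow> cyl D \<sigma> \<in> sets Omega"
  using cyl_in_sets_Fsig[of D D] sets_Fsig_subset by blast

lemma cyl_cong: "(\<And>x. x \<in> L \<Longrightarrow> \<sigma> x = \<tau> x) \<Longrightarrow> cyl L \<sigma> = cyl L \<tau>"
  by (auto simp: cyl_def)

text \<open>The events that do not separate two configurations agreeing on \<open>L\<close> include
  the generators and are closed under complements and countable unions. Hence a level set of
  \<open>f\<close> cannot separate them either.\<close>

lemma borel_measurable_Fsig_determined_by:
  fixes f :: "(int ^ 'd \<Rightarrow> 'e) \<Rightarrow> real"
  assumes "f \<in> borel_measurable (Fsig L)"
  shows "determined_by L f"
proof (rule determined_byI)
  fix \<omega> \<omega>' :: "int ^ 'd \<Rightarrow> 'e" assume eq: "\<And>x. x \<in> L \<Longrightarrow> \<omega> x = \<omega>' x"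
  have *: "\<omega> \<in> B \<longleftrightarrow> \<omega>' \<in> B" if "B \<in> sets (Fsig L)" for B
    using that unfolding sets_Fsig
    by (induction rule: sigma_sets.induct) (use eq in auto)
  have "f -` {f \<omega>} \<inter> space (Fsig L) \<in> sets (Fsig L)"
    by (rule measurable_sets[OF assms]) simp
  from *[OF this] show "f \<omega> = f \<omega>'" by simp
qed

lemma finite_cfgs [simp]: "finite L \<Longrightarrow> finite (cfgs L :: (int ^ 'd \<Rightarrow> 'e::finite) set)"
  unfolding cfgs_def by (intro finite_PiE) auto

lemma restrict_in_cfgs: "restrict \<sigma> L \<in> cfgs L"
  by (simp add: cfgs_def)

text \<open>Elements of \<open>cfgs L\<close> take the value \<open>undefined\<close> off
  \<open>L\<close>, so every pattern on \<open>L\<close> has exactly one representative. Thus the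
  cylinders indexed by \<open>cfgs L\<close> partition the configuration space.\<close>

lemma in_cyl_cfgs_iff: "\<tau> \<in> cfgs L \<Longrightarrow> \<sigma> \<in> cyl L \<tau> \<longleftrightarrow> \<tau> = restrict \<sigma> L"
  by (fastforce simp: cyl_def cfgs_def PiE_def extensional_def restrict_def)

lemma vimage_determined_by_in_sets:
  fixes f :: "(int ^ 'd \<Rightarrow> 'e::finite) \<Rightarrow> 'c"
  assumes "finite L" "determined_by L f"
  shows "f -` B \<in> sets Omega"
proof -
  have "f (restrict \<sigma> L) = f \<sigma>" for \<sigma>
    by (rule determined_byD[OF assms(2)]) auto
  then have "f -` B = (\<Union>\<tau>\<in>cfgs L \<inter> f -` B. cyl L \<tau>)"
    by (auto simp: in_cyl_cfgs_iff restrict_in_cfgs)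
  also have "\<dots> \<in> sets Omega"
    using assms(1) by (intro sets.finite_UN) auto
  finally show ?thesis .
qed

lemma sum_cfgs_insert:
  fixes f :: "(int ^ 'd \<Rightarrow> 'e::finite) \<Rightarrow> real"
  assumes "x \<notin> L"
  shows "(\<Sum>\<tau>\<in>cfgs (insert x L). f \<tau>) = (\<Sum>\<tau>\<in>cfgs L. \<Sum>a\<in>UNIV. f (\<tau>(x := a)))"
proof -
  have "(\<Sum>\<tau>\<in>cfgs (insert x L). f \<tau>) = (\<Sum>(a, \<tau>)\<in>UNIV \<times> cfgs L. f (\<tau>(x := a)))"
    unfolding cfgs_def PiE_insert_eq
    by (subst sum.reindex) (use inj_combinator[OF assms, of "\<lambda>_. UNIV"] in \<open>auto simp: case_prod_beta comp_def\<close>)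
  also have "\<dots> = (\<Sum>a\<in>UNIV. \<Sum>\<tau>\<in>cfgs L. f (\<tau>(x := a)))"
    by (simp add: sum.cartesian_product)
  also have "\<dots> = (\<Sum>\<tau>\<in>cfgs L. \<Sum>a\<in>UNIV. f (\<tau>(x := a)))"
    by (rule sum.swap)
  finally show ?thesis .
qed

lemma measurable_shift: "shift x \<in> Omega \<rightarrow>\<^sub>M Omega"
  unfolding Omega_def shift_def by (rule measurable_PiM_single') auto

lemma cyl_translate: "cyl ((\<lambda>y. y + x) ` L) \<sigma> = shift x -` cyl L (shift x \<sigma>)"
  by (auto simp: cyl_def shift_def add.commute)

section \<open>Measures on configurations and their entropy\<close>

locale config_prob = prob_space \<mu> for \<mu> :: "(int ^ 'd \<Rightarrow> 'e::finite) measure" +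
  assumes sets_eq: "sets \<mu> = sets Omega"
begin

lemma space_eq [simp]: "space \<mu> = UNIV"
  using sets_eq_imp_space_eq[OF sets_eq] by simp

lemma cyl_in_sets [simp]: "finite L \<Longrightarrow> cyl L \<sigma> \<in> sets \<mu>"
  by (simp add: sets_eq)

lemma borel_measurable_determined_by:
  fixes f :: "(int ^ 'd \<Rightarrow> 'e) \<Rightarrow> real"
  assumes "finite L" "determined_by L f"
  shows "f \<in> borel_measurable \<mu>"
  by (rule measurableI) (use vimage_determined_by_in_sets[OF assms] in \<open>auto simp: sets_eq\<close>)

lemma determined_by_eq_sum:
  fixes f :: "(int ^ 'd \<Rightarrow> 'e) \<Rightarrow> real"
  assumes "finite L" "determined_by L f"
  shows "f \<sigma> = (\<Sum>\<tau>\<in>cfgs L. indicator (cyl L \<tau>) \<sigma> * f \<tau>)"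
proof -
  have "(\<Sum>\<tau>\<in>cfgs L. indicator (cyl L \<tau>) \<sigma> * f \<tau>) = (\<Sum>\<tau>\<in>cfgs L. if restrict \<sigma> L = \<tau> then f \<tau> else 0)"
    by (intro sum.cong) (auto simp: in_cyl_cfgs_iff indicator_def)
  also have "\<dots> = f (restrict \<sigma> L)"
    using assms(1) by (simp add: restrict_in_cfgs)
  also have "\<dots> = f \<sigma>"
    by (rule determined_byD[OF assms(2)]) auto
  finally show ?thesis by simp
qed

lemma
  fixes f :: "(int ^ 'd \<Rightarrow> 'e) \<Rightarrow> real"
  assumes "finite L" "determined_by L f"
  shows integrable_determined_by: "integrable \<mu> f"
    and integral_determined_by: "integral\<^sup>L \<mu> f = (\<Sum>\<tau>\<in>cfgs L. measure \<mu> (cyl L \<tau>) * f \<tau>)"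
proof -
  have f: "f = (\<lambda>\<sigma>. \<Sum>\<tau>\<in>cfgs L. indicator (cyl L \<tau>) \<sigma> * f \<tau>)"
    using determined_by_eq_sum[OF assms] by blast
  have int: "integrable \<mu> (\<lambda>\<sigma>. indicator (cyl L \<tau>) \<sigma> * f \<tau>)" for \<tau>
    using assms(1) by (intro integrable_mult_left integrable_real_indicator) (auto simp: emeasure_eq_measure)
  show "integrable \<mu> f"
    by (subst f) (intro Bochner_Integration.integrable_sum int)
  show "integral\<^sup>L \<mu> f = (\<Sum>\<tau>\<in>cfgs L. measure \<mu> (cyl L \<tau>) * f \<tau>)"
    by (subst f, subst Bochner_Integration.integral_sum[OF int]) simp
qed

text \<open>Both integrals are finite sums weighted by cylinder masses, so the comparison matters
  only where the mass is positive. Logarithms of vanishing probabilities therefore never have to be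
  compared.\<close>

lemma integral_determined_by_mono:
  fixes f g :: "(int ^ 'd \<Rightarrow> 'e) \<Rightarrow> real"
  assumes "finite L" "determined_by L f" "determined_by L g"
    and "\<And>\<sigma>. measure \<mu> (cyl L \<sigma>) > 0 \<Longrightarrow> f \<sigma> \<le> g \<sigma>"
  shows "integral\<^sup>L \<mu> f \<le> integral\<^sup>L \<mu> g"
  unfolding integral_determined_by[OF assms(1,2)] integral_determined_by[OF assms(1,3)]
proof (rule sum_mono)
  fix \<tau>
  show "measure \<mu> (cyl L \<tau>) * f \<tau> \<le> measure \<mu> (cyl L \<tau>) * g \<tau>"
    using assms(4)[of \<tau>] by (cases "measure \<mu> (cyl L \<tau>) = 0")
      (auto intro!: mult_left_mono simp: less_le)
qed

lemma sum_measure_cyl: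
  assumes "finite L"
  shows "(\<Sum>\<tau>\<in>cfgs L. measure \<mu> (cyl L \<tau>)) = 1"
  using integral_determined_by[OF assms, of "\<lambda>_. 1"] prob_space by (simp add: determined_by_def)

lemma sum_measure_cyl_insert:
  assumes "finite L" "x \<notin> L"
  shows "(\<Sum>a\<in>UNIV. measure \<mu> (cyl (insert x L) (\<sigma>(x := a)))) = measure \<mu> (cyl L \<sigma>)"
proof -
  have "cyl L \<sigma> = (\<Union>a\<in>UNIV. cyl (insert x L) (\<sigma>(x := a)))"
    using assms(2) by (auto simp: cyl_def)
  moreover have "measure \<mu> (\<Union>a\<in>UNIV. cyl (insert x L) (\<sigma>(x := a))) =
      (\<Sum>a\<in>UNIV. measure \<mu> (cyl (insert x L) (\<sigma>(x := a))))"
  proof (rule finite_measure_finite_Union)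
    show "disjoint_family (\<lambda>a. cyl (insert x L) (\<sigma>(x := a)))"
      by (auto simp: disjoint_family_on_def cyl_def)
  qed (use assms in auto)
  ultimately show ?thesis by simp
qed

lemma measure_cyl_antimono:
  "finite L \<Longrightarrow> K \<subseteq> L \<Longrightarrow> measure \<mu> (cyl L \<sigma>) \<le> measure \<mu> (cyl K \<sigma>)"
  by (rule finite_measure_mono[OF _ cyl_in_sets]) (auto simp: cyl_def intro: finite_subset)

section \<open>Entropy of finite windows and its submodularity\<close>

lemma determined_by_measure_cyl:
  "K \<subseteq> L \<Longrightarrow> determined_by L (\<lambda>\<sigma>. g (measure \<mu> (cyl K \<sigma>)))"
  by (intro determined_byI arg_cong[of _ _ g] arg_cong[of _ _ "measure \<mu>"] cyl_cong) auto

text \<open>Shannon entropy as the mean information content; in this form its inequalities become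
  pointwise inequalities under the integral.\<close>

definition H :: "(int ^ 'd) set \<Rightarrow> real" where
  "H L = - (\<integral>\<sigma>. ln (measure \<mu> (cyl L \<sigma>)) \<partial>\<mu>)"

lemma ent_box_eq: "finite L \<Longrightarrow> ent_box \<mu> L = H L"
  unfolding ent_box_def H_def by (subst integral_determined_by) (auto intro: determined_by_measure_cyl)

lemma H_empty [simp]: "H {} = 0"
  using prob_space by (simp add: H_def cyl_def)

lemma H_mono:
  assumes "finite L" "K \<subseteq> L"
  shows "H K \<le> H L"
  unfolding H_def neg_le_iff_le
proof (rule integral_determined_by_mono[OF assms(1)])
  fix \<sigma> assume "measure \<mu> (cyl L \<sigma>) > 0"
  with measure_cyl_antimono[OF assms, of \<sigma>]
  show "ln (measure \<mu> (cyl L \<sigma>)) \<le> ln (measure \<mu> (cyl K \<sigma>))" by simp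
qed (use assms in \<open>auto intro: determined_by_measure_cyl\<close>)

text \<open>This is nonnegativity of the conditional mutual information of the spins at
  \<open>x\<close> and \<open>z\<close> given \<open>A\<close>. It follows from
  \<open>ln t \<le> t - 1\<close> with \<open>t\<close> the ratio \<open>?r\<close>, whose mean is
  at most 1.\<close>

lemma H_strong_subadditive_point:
  assumes fin: "finite A" and x: "x \<notin> A" and z: "z \<notin> A" and xz: "x \<noteq> z"
  shows "H (insert x (insert z A)) - H (insert z A) \<le> H (insert x A) - H A"
proof -
  let ?L = "insert x (insert z A)"
  let ?p = "\<lambda>K \<sigma>. measure \<mu> (cyl K \<sigma>)"
  \<comment> \<open>The probability that would hold if the spins at \<open>x\<close> and
    \<open>z\<close> were conditionally independent given \<open>A\<close>, divided by the true
    one.\<close>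
  let ?r = "\<lambda>\<sigma>. ?p (insert z A) \<sigma> * ?p (insert x A) \<sigma> / (?p ?L \<sigma> * ?p A \<sigma>)"
  have finL: "finite ?L" using fin by simp
  have subL: "insert x A \<subseteq> ?L" "insert z A \<subseteq> ?L" "A \<subseteq> ?L" by auto
  have det: "K \<subseteq> ?L \<Longrightarrow> determined_by ?L (\<lambda>\<sigma>. ln (?p K \<sigma>))" for K
    by (rule determined_by_measure_cyl)
  note int = integrable_determined_by[OF finL det]
  \<comment> \<open>An arbitrary \<open>g\<close> of the four cylinder probabilities covers every
    integrand below at once.\<close>
  have det4: "determined_by ?L (\<lambda>\<sigma>. g (?p (insert z A) \<sigma>) (?p (insert x A) \<sigma>) (?p ?L \<sigma>) (?p A \<sigma>))"
    for g :: "real \<Rightarrow> real \<Rightarrow> real \<Rightarrow> real \<Rightarrow> real"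
    by (intro determined_byI arg_cong4[where f = g] arg_cong[where f = "measure \<mu>"] cyl_cong) auto
  have "(\<integral>\<sigma>. ln (?p (insert z A) \<sigma>) + ln (?p (insert x A) \<sigma>) - ln (?p ?L \<sigma>) - ln (?p A \<sigma>) \<partial>\<mu>)
      \<le> (\<integral>\<sigma>. ?r \<sigma> - 1 \<partial>\<mu>)"
  proof (rule integral_determined_by_mono[OF finL])
    fix \<sigma> assume pos: "?p ?L \<sigma> > 0"
    then have "?p (insert x A) \<sigma> > 0" "?p (insert z A) \<sigma> > 0" "?p A \<sigma> > 0"
      using measure_cyl_antimono[OF finL subL(1), of \<sigma>] measure_cyl_antimono[OF finL subL(2), of \<sigma>]
        measure_cyl_antimono[OF finL subL(3), of \<sigma>] by linarith+
    with pos have "ln (?r \<sigma>) = ln (?p (insert z A) \<sigma>) + ln (?p (insert x A) \<sigma>) - ln (?p ?L \<sigma>) - ln (?p A \<sigma>)"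
      "?r \<sigma> > 0"
      by (simp_all add: ln_mult ln_div)
    then show "ln (?p (insert z A) \<sigma>) + ln (?p (insert x A) \<sigma>) - ln (?p ?L \<sigma>) - ln (?p A \<sigma>) \<le> ?r \<sigma> - 1"
      using ln_le_minus_one[of "?r \<sigma>"] by simp
  qed (rule det4[of "\<lambda>a b c d. ln a + ln b - ln c - ln d"], rule det4[of "\<lambda>a b c d. a * b / (c * d) - 1"])
  also have "\<dots> = (\<integral>\<sigma>. ?r \<sigma> \<partial>\<mu>) - 1"
    using integrable_determined_by[OF finL det4[of "\<lambda>a b c d. a * b / (c * d)"]] prob_space
    by (subst Bochner_Integration.integral_diff) auto
  also have "(\<integral>\<sigma>. ?r \<sigma> \<partial>\<mu>) = (\<Sum>\<tau>\<in>cfgs ?L. ?p ?L \<tau> * ?r \<tau>)"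
    by (rule integral_determined_by[OF finL det4[of "\<lambda>a b c d. a * b / (c * d)"]])
  \<comment> \<open>Only an inequality, because cylinders over \<open>?L\<close> of mass zero drop
    out on the left.\<close>
  also have "\<dots> \<le> (\<Sum>\<tau>\<in>cfgs ?L. ?p (insert z A) \<tau> * ?p (insert x A) \<tau> / ?p A \<tau>)"
    by (intro sum_mono) auto
  also have "\<dots> = (\<Sum>\<tau>\<in>cfgs A. \<Sum>b\<in>UNIV. \<Sum>a\<in>UNIV.
      ?p (insert z A) (\<tau>(z := b, x := a)) * ?p (insert x A) (\<tau>(z := b, x := a)) / ?p A (\<tau>(z := b, x := a)))"
    using assms by (simp add: sum_cfgs_insert)
  also have "\<dots> = (\<Sum>\<tau>\<in>cfgs A. \<Sum>b\<in>UNIV. \<Sum>a\<in>UNIV.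
      ?p (insert z A) (\<tau>(z := b)) * ?p (insert x A) (\<tau>(x := a)) / ?p A \<tau>)"
    using assms by (intro sum.cong refl arg_cong2[where f = "(/)"] arg_cong2[where f = "(*)"]
        arg_cong[where f = "measure \<mu>"] cyl_cong) auto
  \<comment> \<open>One factor depends only on the spin at \<open>z\<close> and the other only on
    the spin at \<open>x\<close>, so the double sum factorizes; each factor then sums to the mass of
    \<open>cyl A \<tau>\<close>.\<close>
  also have "\<dots> = (\<Sum>\<tau>\<in>cfgs A. (\<Sum>b\<in>UNIV. ?p (insert z A) (\<tau>(z := b))) *
      (\<Sum>a\<in>UNIV. ?p (insert x A) (\<tau>(x := a))) / ?p A \<tau>)"
    by (intro sum.cong refl) (simp add: sum_product sum_divide_distrib)
  also have "\<dots> = (\<Sum>\<tau>\<in>cfgs A. ?p A \<tau>)"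
    using assms by (intro sum.cong refl) (simp add: sum_measure_cyl_insert)
  also have "\<dots> = 1" by (rule sum_measure_cyl[OF fin])
  finally have "(\<integral>\<sigma>. ln (?p (insert z A) \<sigma>) + ln (?p (insert x A) \<sigma>) - ln (?p ?L \<sigma>) - ln (?p A \<sigma>) \<partial>\<mu>) \<le> 0"
    by simp
  then show ?thesis
    unfolding H_def using int[OF subL(1)] int[OF subL(2)] int[OF subL(3)] int[OF order_refl] by simp
qed

text \<open>The points of \<open>B\<close> are added to \<open>A\<close> one at a time, each by
  \<open>H_strong_subadditive_point\<close>; a point already present changes nothing.\<close>

lemma H_increment_antimono:
  assumes "finite B" "A \<subseteq> B" "x \<notin> B"
  shows "H (insert x B) - H B \<le> H (insert x A) - H A"
proof -
  have finA: "finite A" and x: "x \<notin> A" using assms finite_subset by auto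
  have "finite D \<Longrightarrow> x \<notin> D \<Longrightarrow> H (insert x (A \<union> D)) - H (A \<union> D) \<le> H (insert x A) - H A" for D
  proof (induction D rule: finite_induct)
    case (insert z D)
    then show ?case
      using H_strong_subadditive_point[of "A \<union> D" x z] finA x
      by (cases "z \<in> A \<union> D") (auto simp: insert_absorb)
  qed simp
  from this[OF assms(1,3)] assms(2) show ?thesis by (simp add: Un_absorb1)
qed

end

section \<open>The lexicographic order\<close>

lemma lex_less_iff: "lex_le x y \<and> x \<noteq> y \<longleftrightarrow> (\<exists>i. x $ i < y $ i \<and> (\<forall>j<i. x $ j = y $ j))"
  by (auto simp: lex_le_def)

text \<open>The deciding coordinate for \<open>x\<close> and \<open>z\<close> is the smaller of the
  two given deciding coordinates.\<close>

lemma lex_less_trans: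
  assumes "lex_le x y \<and> x \<noteq> y" "lex_le y z \<and> y \<noteq> z"
  shows "lex_le x z \<and> x \<noteq> z"
proof -
  from assms obtain i j where "x $ i < y $ i" "\<forall>k<i. x $ k = y $ k" "y $ j < z $ j" "\<forall>k<j. y $ k = z $ k"
    unfolding lex_less_iff by blast
  then have "x $ (min i j) < z $ (min i j) \<and> (\<forall>k<min i j. x $ k = z $ k)"
    by (cases i j rule: linorder_cases) (auto simp: min_def)
  then show ?thesis unfolding lex_less_iff by blast
qed

lemma lex_le_total: "lex_le x y \<or> lex_le y x"
proof (cases "x = y")
  case False
  define i where "i = Min {i. x $ i \<noteq> y $ i}"
  have "{i. x $ i \<noteq> y $ i} \<noteq> {}" using False by (auto simp: vec_eq_iff)
  then have "x $ i \<noteq> y $ i" unfolding i_def using Min_in[of "{i. x $ i \<noteq> y $ i}"] by simp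
  moreover have "x $ j = y $ j" if "j < i" for j
    using Min_le[of "{i. x $ i \<noteq> y $ i}" j] that unfolding i_def by fastforce
  ultimately show ?thesis
    unfolding lex_le_def by (metis linorder_neqE_linordered_idom)
qed (simp add: lex_le_def)

lemma lex_le_antisym: "lex_le x y \<Longrightarrow> lex_le y x \<Longrightarrow> x = y"
  using lex_less_trans[of x y x] by auto

lemma lex_le_add_left: "lex_le (x + y) x \<longleftrightarrow> lex_le y 0"
  by (simp add: lex_le_def)

definition lex_past :: "(int ^ ('d::{finite,linorder})) set \<Rightarrow> int ^ ('d::{finite,linorder}) \<Rightarrow> (int ^ ('d::{finite,linorder})) set" where
  "lex_past S x = {y \<in> S. lex_le y x \<and> y \<noteq> x}"

text \<open>Induction by removing the lexicographic maximum \<open>m\<close> of \<open>S\<close>: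
  the past of \<open>m\<close> is all the rest, and \<open>m\<close> lies in the past of no other
  point. The set function is arbitrary so that the lemma serves both entropies and mean log
  likelihoods.\<close>

lemma sum_lex_past_telescope:
  fixes F :: "(int ^ ('d::{finite,linorder})) set \<Rightarrow> real"
  assumes "finite S"
  shows "(\<Sum>x\<in>S. F (insert x (lex_past S x)) - F (lex_past S x)) = F S - F {}"
  using assms
proof (induction S rule: finite_psubset_induct)
  case (psubset S)
  show ?case
  proof (cases "S = {}")
    case False
    let ?R = "\<lambda>x y :: (int, 'd) vec. lex_le x y \<and> x \<noteq> y"
    have "asymp_on S ?R" by (rule asymp_onI) (auto dest: lex_le_antisym)
    moreover have "transp_on S ?R" by (rule transp_onI) (rule lex_less_trans)
    ultimately obtain m where m: "m \<in> S" "\<forall>x\<in>S. x \<noteq> m \<longrightarrow> \<not> ?R m x"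
      using Finite_Set.bex_max_element[of S ?R] psubset(1) False by blast
    then have max: "lex_le x m" "\<not> lex_le m x" if "x \<in> S - {m}" for x
      using that lex_le_total[of x m] by auto
    have past_m: "lex_past S m = S - {m}"
      using max by (auto simp: lex_past_def)
    have past: "lex_past S x = lex_past (S - {m}) x" if "x \<in> S - {m}" for x
      using max(2)[OF that] by (auto simp: lex_past_def)
    have "(\<Sum>x\<in>S. F (insert x (lex_past S x)) - F (lex_past S x)) =
        F (insert m (S - {m})) - F (S - {m}) +
        (\<Sum>x\<in>S - {m}. F (insert x (lex_past (S - {m}) x)) - F (lex_past (S - {m}) x))"
      by (subst sum.remove[OF psubset(1) m(1)]) (simp add: past_m past)
    also have "\<dots> = F S - F {}"
      by (subst psubset.IH) (use m(1) in \<open>auto simp: insert_absorb\<close>)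
    finally show ?thesis .
  qed simp
qed

section \<open>Averages over boxes\<close>

lemma box_eq_image: "box n = vec_lambda ` PiE (UNIV :: 'd::finite set) (\<lambda>_. {-int n..int n})"
proof
  show "box n \<subseteq> vec_lambda ` PiE (UNIV :: 'd set) (\<lambda>_. {-int n..int n})"
  proof
    fix x :: "int ^ 'd" assume "x \<in> box n"
    then have "vec_nth x \<in> PiE UNIV (\<lambda>_. {-int n..int n})" by (auto simp: box_def abs_le_iff minus_le_iff)
    then show "x \<in> vec_lambda ` PiE (UNIV :: 'd set) (\<lambda>_. {-int n..int n})"
      by (metis image_eqI vec_lambda_eta)
  qed
qed (auto simp: box_def abs_le_iff minus_le_iff PiE_def Pi_def)

lemma finite_box [simp]: "finite (box n)"
  unfolding box_eq_image by (intro finite_imageI finite_PiE) auto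

lemma card_box: "card (box n :: (int ^ 'd) set) = (2 * n + 1) ^ CARD('d)"
proof -
  have "inj_on vec_lambda (PiE (UNIV :: 'd set) (\<lambda>_. {-int n..int n}))"
    by (rule inj_onI) (simp add: vec_lambda_inject)
  then have "card (box n :: (int ^ 'd) set) = card (PiE (UNIV :: 'd set) (\<lambda>_. {-int n..int n}))"
    unfolding box_eq_image by (rule card_image)
  then show ?thesis by (simp add: card_PiE nat_add_distrib nat_mult_distrib)
qed

lemma card_box_pos [simp]: "card (box n :: (int ^ 'd) set) > 0"
  by (simp add: card_box)

lemma box_mono: "m \<le> n \<Longrightarrow> box m \<subseteq> box n"
  by (auto simp: box_def intro: order_trans)

lemma finite_subset_box:
  fixes A :: "(int ^ 'd) set"
  assumes "finite A"
  shows "\<exists>k. A \<subseteq> box k"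
  using assms
proof (induction A rule: finite_induct)
  case (insert x A)
  then obtain k where k: "A \<subseteq> box k" by blast
  define m where "m = Max (range (\<lambda>i. nat \<bar>x $ i\<bar>))"
  have "nat \<bar>x $ i\<bar> \<le> m" for i unfolding m_def by (rule Max_ge) auto
  then have "x \<in> box m" by (simp add: box_def nat_le_iff)
  with k box_mono[of k "max k m"] box_mono[of m "max k m"] show ?case
    by (intro exI[of _ "max k m"]) auto
qed simp

lemma box_add: "k \<le> n \<Longrightarrow> x \<in> box (n - k) \<Longrightarrow> y \<in> box k \<Longrightarrow> x + y \<in> box n"
proof -
  assume k: "k \<le> n" and "x \<in> box (n - k)" "y \<in> box k"
  then have "\<bar>x $ i\<bar> \<le> int n - int k" "\<bar>y $ i\<bar> \<le> int k" for i
    by (auto simp: box_def of_nat_diff)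
  then have "\<bar>x $ i + y $ i\<bar> \<le> int n" for i
    using abs_triangle_ineq[of "x $ i" "y $ i"] by (smt (verit))
  then show ?thesis by (simp add: box_def)
qed

lemma card_inner_box_ratio:
  "(\<lambda>n. real (card (box (n - k) :: (int ^ 'd) set)) / real (card (box n :: (int ^ 'd) set))) \<longlonglongrightarrow> 1"
proof -
  have "(\<lambda>n. (2 * real n + 1) / (2 * (real n + real k) + 1)) \<longlonglongrightarrow> 1"
    by real_asymp
  \<comment> \<open>Passing to the index \<open>n + k\<close> makes the truncated subtraction
    \<open>n - k\<close> harmless; the offset is removed afterwards.\<close>
  then have "(\<lambda>n. (2 * real (n + k - k) + 1) / (2 * real (n + k) + 1)) \<longlonglongrightarrow> 1"
    by simp
  then have "(\<lambda>n. (2 * real (n - k) + 1) / (2 * real n + 1)) \<longlonglongrightarrow> 1"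
    by (rule LIMSEQ_offset)
  from tendsto_power[OF this, of "CARD('d)"] show ?thesis
    by (simp add: card_box power_divide add.commute)
qed

text \<open>Sites of \<open>box (n - k)\<close> satisfy the premise of \<open>near\<close> by
  \<open>box_add\<close>. All other sites form a vanishing fraction of the box, and there the crude
  bound \<open>M\<close> suffices.\<close>

lemma box_average_tendsto:
  fixes f :: "nat \<Rightarrow> int ^ 'd \<Rightarrow> real"
  assumes bdd: "\<And>n x. x \<in> box n \<Longrightarrow> \<bar>f n x - c\<bar> \<le> M"
    and near: "\<And>\<epsilon>. \<epsilon> > 0 \<Longrightarrow> \<exists>k. \<forall>n x. x \<in> box n \<longrightarrow> (\<forall>y\<in>box k. x + y \<in> box n) \<longrightarrow> \<bar>f n x - c\<bar> \<le> \<epsilon>"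
  shows "(\<lambda>n. (\<Sum>x\<in>box n. f n x) / real (card (box n :: (int ^ 'd) set))) \<longlonglongrightarrow> c"
proof (rule tendstoI)
  fix \<epsilon> :: real assume \<epsilon>: "\<epsilon> > 0"
  let ?N = "\<lambda>n. real (card (box n :: (int ^ 'd) set))"
  obtain k where k: "\<And>n x. x \<in> box n \<Longrightarrow> (\<forall>y\<in>box k. x + y \<in> box n) \<Longrightarrow> \<bar>f n x - c\<bar> \<le> \<epsilon> / 2"
    using near[of "\<epsilon> / 2"] \<epsilon> by auto
  have M: "M \<ge> 0" using bdd[of 0 0] by (auto simp: box_def)
  have "(\<lambda>n. M * (1 - ?N (n - k) / ?N n)) \<longlonglongrightarrow> M * (1 - 1)"
    by (intro tendsto_intros card_inner_box_ratio)
  then have "eventually (\<lambda>n. M * (1 - ?N (n - k) / ?N n) < \<epsilon> / 2) sequentially"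
    by (rule order_tendstoD) (use \<epsilon> in simp)
  then show "eventually (\<lambda>n. dist ((\<Sum>x\<in>box n. f n x) / ?N n) c < \<epsilon>) sequentially"
    using eventually_ge_at_top[of k]
  proof eventually_elim
    case (elim n)
    have sub: "box (n - k) \<subseteq> (box n :: (int ^ 'd) set)" by (intro box_mono) simp
    have pos: "?N n > 0" by simp
    have "\<bar>\<Sum>x\<in>box n. f n x - c\<bar> \<le> (\<Sum>x\<in>box n. \<bar>f n x - c\<bar>)"
      by (rule sum_abs)
    also have "\<dots> \<le> (\<Sum>x\<in>(box n :: (int ^ 'd) set). \<epsilon> / 2 + (if x \<in> box (n - k) then 0 else M))"
    proof (rule sum_mono)
      fix x :: "int ^ 'd" assume x: "x \<in> box n"
      show "\<bar>f n x - c\<bar> \<le> \<epsilon> / 2 + (if x \<in> box (n - k) then 0 else M)"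
        using k[OF x] bdd[OF x] box_add[of k n x] elim(2) \<epsilon> by auto
    qed
    also have "\<dots> = \<epsilon> / 2 * ?N n + M * real (card (box n - box (n - k) :: (int ^ 'd) set))"
      by (simp add: sum.distrib sum.If_cases set_diff_eq Int_def conj_commute)
    also have "real (card (box n - box (n - k) :: (int ^ 'd) set)) = ?N n - ?N (n - k)"
      using sub by (subst card_Diff_subset) (auto simp: of_nat_diff card_mono intro: finite_subset)
    finally have "\<bar>\<Sum>x\<in>box n. f n x - c\<bar> / ?N n \<le> (\<epsilon> / 2 * ?N n + M * (?N n - ?N (n - k))) / ?N n"
      using pos by (intro divide_right_mono) auto
    also have "\<dots> = \<epsilon> / 2 + M * (1 - ?N (n - k) / ?N n)"
      using less_imp_neq[OF pos] by (simp add: add_divide_distrib diff_divide_distrib right_diff_distrib)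
    finally have "\<bar>\<Sum>x\<in>box n. f n x - c\<bar> / ?N n \<le> \<epsilon> / 2 + M * (1 - ?N (n - k) / ?N n)" .
    moreover have "(\<Sum>x\<in>box n. f n x) / ?N n - c = (\<Sum>x\<in>box n. f n x - c) / ?N n"
      using less_imp_neq[OF pos] by (simp add: sum_subtractf diff_divide_distrib)
    ultimately have "dist ((\<Sum>x\<in>box n. f n x) / ?N n) c \<le> \<epsilon> / 2 + M * (1 - ?N (n - k) / ?N n)"
      by (simp add: dist_real_def)
    with elim(1) show ?case by linarith
  qed
qed

section \<open>Existence of the specific entropy\<close>

locale inv_config_prob = config_prob \<mu> for \<mu> :: "(int ^ ('d::{finite,linorder}) \<Rightarrow> 'e::finite) measure" +
  assumes inv: "A \<in> sets Omega \<Longrightarrow> measure \<mu> (shift x -` A) = measure \<mu> A"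
begin

lemma measurable_shift': "shift x \<in> \<mu> \<rightarrow>\<^sub>M \<mu>"
  using measurable_shift by (simp cong: measurable_cong_sets add: sets_eq)

lemma distr_shift: "distr \<mu> \<mu> (shift x) = \<mu>"
  by (rule measure_eqI)
     (auto simp: emeasure_distr[OF measurable_shift'] emeasure_eq_measure inv sets_eq)

lemma integral_shift:
  fixes f :: "((int, 'd) vec \<Rightarrow> 'e) \<Rightarrow> real"
  assumes "f \<in> borel_measurable \<mu>"
  shows "(\<integral>\<sigma>. f (shift x \<sigma>) \<partial>\<mu>) = (\<integral>\<sigma>. f \<sigma> \<partial>\<mu>)"
  using integral_distr[OF measurable_shift' assms, of x] by (simp add: distr_shift)

lemma H_translate:
  assumes "finite L"
  shows "H ((\<lambda>y. y + x) ` L) = H L"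
proof -
  have "(\<integral>\<sigma>. ln (measure \<mu> (cyl ((\<lambda>y. y + x) ` L) \<sigma>)) \<partial>\<mu>) = (\<integral>\<sigma>. ln (measure \<mu> (cyl L (shift x \<sigma>))) \<partial>\<mu>)"
    using assms by (simp add: cyl_translate inv)
  also have "\<dots> = (\<integral>\<sigma>. ln (measure \<mu> (cyl L \<sigma>)) \<partial>\<mu>)"
    by (rule integral_shift[OF borel_measurable_determined_by[OF assms determined_by_measure_cyl]]) simp
  finally show ?thesis by (simp add: H_def)
qed

text \<open>By the chain rule along the lexicographic order, the entropy of a box is a sum of conditional
  entropies of a site given its past within the box, and these decrease as the past grows.\<close>
lemma convergent_ent_seq: "convergent (ent_seq \<mu>)"
proof -
  define g where "g A = H (insert 0 A) - H A" for A
  define P where "P = {A :: (int, 'd) vec set. finite A \<and> A \<subseteq> {y. lex_le y 0 \<and> y \<noteq> 0}}"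
  \<comment> \<open>\<open>P\<close> consists of the finite parts of the strict past of the origin,
    and \<open>c\<close> plays the role of the conditional entropy at the origin given its whole
    past. It is the limit to be found.\<close>
  define c where "c = (INF A\<in>P. g A)"
  define f where "f n x = H (insert x (lex_past (box n) x)) - H (lex_past (box n) x)" for n x
  have g_nonneg: "g A \<ge> 0" if "A \<in> P" for A
    using that H_mono[of "insert 0 A" A] by (auto simp: P_def g_def)
  have bdd: "bdd_below (g ` P)" using g_nonneg by (intro bdd_belowI[of _ 0]) auto
  have antimono: "g B \<le> g A" if "B \<in> P" "A \<subseteq> B" for A B
    unfolding g_def using that by (intro H_increment_antimono) (auto simp: P_def)
  have P_empty: "{} \<in> P" by (simp add: P_def)
  have c_le: "c \<le> g A" if "A \<in> P" for A
    unfolding c_def using bdd that by (rule cINF_lower)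
  \<comment> \<open>The past of \<open>x\<close> within the box, recentred at the origin.
    Translation invariance then turns each increment into a value of \<open>g\<close> on
    \<open>P\<close>.\<close>
  define past where "past n x = {y. x + y \<in> box n \<and> lex_le y 0 \<and> y \<noteq> 0}" for n and x :: "(int, 'd) vec"
  have lex_past_eq: "lex_past (box n) x = (\<lambda>y. y + x) ` past n x" for n x
  proof -
    have "z \<in> (\<lambda>y. y + x) ` past n x" if "z \<in> lex_past (box n) x" for z
      using that lex_le_add_left[of x "z - x"]
      by (intro image_eqI[of _ _ "z - x"]) (auto simp: lex_past_def past_def)
    then show ?thesis
      by (auto simp: lex_past_def past_def lex_le_add_left add.commute[of _ x])
  qed
  have fin_past: "finite (past n x)" for n x
  proof -
    have "past n x \<subseteq> (\<lambda>z. z - x) ` box n"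
      by (auto simp: past_def intro!: image_eqI[of _ _ "x + _"])
    then show ?thesis by (rule finite_subset) simp
  qed
  have past_P: "past n x \<in> P" for n x
    using fin_past by (auto simp: P_def past_def)
  have f_eq: "f n x = g (past n x)" for n x
  proof -
    have "insert x (lex_past (box n) x) = (\<lambda>y. y + x) ` insert 0 (past n x)"
      by (simp add: lex_past_eq)
    then show ?thesis
      unfolding f_def g_def using fin_past
      by (simp only: lex_past_eq H_translate finite_insert)
  qed
  have "(\<lambda>n. (\<Sum>x\<in>box n. f n x) / real (card (box n :: (int, 'd) vec set))) \<longlonglongrightarrow> c"
  proof (rule box_average_tendsto)
    fix n and x :: "(int, 'd) vec"
    show "\<bar>f n x - c\<bar> \<le> g {} - c"
      using c_le[OF past_P, of n x] antimono[OF past_P, of "{}" n x] by (simp add: f_eq)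
  next
    fix \<epsilon> :: real assume "\<epsilon> > 0"
    then obtain A where A: "A \<in> P" "g A < c + \<epsilon>"
      using cINF_less_iff[of P g "c + \<epsilon>"] bdd P_empty unfolding c_def by force
    obtain k where k: "A \<subseteq> box k" using finite_subset_box[of A] A(1) by (auto simp: P_def)
    have "\<bar>f n x - c\<bar> \<le> \<epsilon>" if "\<forall>y\<in>box k. x + y \<in> box n" for n x
    proof -
      \<comment> \<open>Once \<open>x\<close> is far enough from the boundary its recentred past
        contains \<open>A\<close>, so the increment is squeezed between \<open>c\<close> and
        \<open>g A\<close>.\<close>
      have "A \<subseteq> past n x" using that k A(1) by (auto simp: past_def P_def)
      then show ?thesis
        using c_le[OF past_P, of n x] antimono[OF past_P, of A n x] A(2) by (simp add: f_eq)
    qed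
    then show "\<exists>k. \<forall>n x. x \<in> box n \<longrightarrow> (\<forall>y\<in>box k. x + y \<in> box n) \<longrightarrow> \<bar>f n x - c\<bar> \<le> \<epsilon>"
      by blast
  qed
  moreover have "(\<Sum>x\<in>box n. f n x) = ent_box \<mu> (box n)" for n
    unfolding f_def using sum_lex_past_telescope[of "box n" H] by (simp add: ent_box_eq)
  ultimately have "ent_seq \<mu> \<longlonglongrightarrow> c"
    unfolding ent_seq_def by simp
  then show ?thesis by (rule convergentI)
qed

end

section \<open>Passage to the locales, and auxiliary estimates\<close>

lemma is_prob_config_prob: "is_prob \<mu> \<Longrightarrow> config_prob \<mu>"
  by (simp add: is_prob_def config_prob_def config_prob_axioms_def)

lemma inv_measure_inv_config_prob: "inv_measure \<mu> \<Longrightarrow> inv_config_prob \<mu>"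
  by (simp add: inv_measure_def inv_config_prob_def inv_config_prob_axioms_def is_prob_config_prob)

lemma borel_measurable_Fsig_Omega:
  "f \<in> borel_measurable (Fsig L) \<Longrightarrow> f \<in> borel_measurable Omega"
  using sets_Fsig_subset[of L] by (auto simp: measurable_def)

text \<open>The tangent bound for \<open>ln\<close>, applied in both directions. It turns closeness
  of kernel values into closeness of their logarithms.\<close>

lemma abs_ln_diff_le:
  fixes s t \<delta> :: real
  assumes "\<delta> > 0" "s \<ge> \<delta>" "t \<ge> \<delta>"
  shows "\<bar>ln s - ln t\<bar> \<le> \<bar>s - t\<bar> / \<delta>"
proof -
  have *: "ln u - ln v \<le> \<bar>u - v\<bar> / \<delta>" if "u \<ge> \<delta>" "v \<ge> \<delta>" for u v
  proof -
    have "ln u - ln v \<le> (u - v) / v"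
      using that assms(1) by (intro ln_diff_le) auto
    also have "\<dots> \<le> \<bar>u - v\<bar> / \<delta>"
      using that assms(1) by (intro frac_le) auto
    finally show ?thesis .
  qed
  from *[OF assms(2,3)] *[OF assms(3,2)] show ?thesis
    by (simp add: abs_le_iff abs_minus_commute)
qed

text \<open>A basic neighbourhood constrains only finitely many coordinates, and agreeing with
  \<open>\<omega>\<close> at those is enough to lie in it.\<close>

lemma openin_Ptop_cyl:
  assumes "openin Ptop U" "\<omega> \<in> U"
  obtains D where "finite D" "cyl D \<omega> \<subseteq> U"
proof -
  from assms obtain V where V: "finite {i. V i \<noteq> UNIV}" "\<omega> \<in> PiE UNIV V" "PiE UNIV V \<subseteq> U"
    unfolding Ptop_def openin_product_topology_alt by auto
  have "cyl {i. V i \<noteq> UNIV} \<omega> \<subseteq> PiE UNIV V"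
  proof
    fix \<omega>' assume \<omega>': "\<omega>' \<in> cyl {i. V i \<noteq> UNIV} \<omega>"
    have "\<omega>' i \<in> V i" for i
      using \<omega>' V(2) by (cases "V i = UNIV") (auto simp: cyl_def PiE_def Pi_def)
    then show "\<omega>' \<in> PiE UNIV V" by auto
  qed
  from that[OF V(1) order_trans[OF this V(3)]] show ?thesis .
qed

section \<open>Gibbs measures of a translation-invariant specification\<close>

locale inv_specification =
  fixes \<gamma> :: "(int ^ ('d::{finite,linorder})) set \<Rightarrow> (int ^ ('d::{finite,linorder}) \<Rightarrow> 'e::finite) \<Rightarrow> (int ^ ('d::{finite,linorder}) \<Rightarrow> 'e) measure"
  assumes spec: "is_specification \<gamma>" and nonnull: "nonnull \<gamma>" and trans_inv: "trans_inv_spec \<gamma>"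
begin

lemma borel_measurable_kernel_Fsig:
  "finite L \<Longrightarrow> A \<in> sets Omega \<Longrightarrow> (\<lambda>\<omega>. measure (\<gamma> L \<omega>) A) \<in> borel_measurable (Fsig (- L))"
  using spec by (simp add: is_specification_def)

lemma is_prob_kernel: "finite L \<Longrightarrow> is_prob (\<gamma> L \<omega>)"
  using spec by (simp add: is_specification_def)

lemma determined_by_gamma0: "determined_by (- {0}) (gamma0 \<gamma> a)"
  unfolding gamma0_def
  by (intro borel_measurable_Fsig_determined_by borel_measurable_kernel_Fsig coordinate_in_sets_Omega) simp

lemma borel_measurable_gamma0: "gamma0 \<gamma> a \<in> borel_measurable Omega"
  unfolding gamma0_def
  by (intro borel_measurable_Fsig_Omega[OF borel_measurable_kernel_Fsig] coordinate_in_sets_Omega) simp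

lemma gamma0_nonneg: "gamma0 \<gamma> a \<omega> \<ge> 0"
  by (simp add: gamma0_def)

lemma gamma0_le_1: "gamma0 \<gamma> a \<omega> \<le> 1"
proof -
  interpret prob_space "\<gamma> {0} \<omega>"
    using is_prob_kernel[of "{0}" \<omega>] by (simp add: is_prob_def)
  show ?thesis by (simp add: gamma0_def)
qed

lemma gamma0_lower_bound: "\<exists>\<delta>>0. \<forall>a \<omega>. gamma0 \<gamma> a \<omega> \<ge> \<delta>"
proof -
  obtain \<delta> where "\<delta> > 0" and \<delta>: "\<And>\<sigma> \<eta>. \<delta> < measure (\<gamma> {0} \<eta>) (cyl {0} \<sigma>)"
    using nonnull unfolding nonnull_def by (metis finite.emptyI finite_insert insert_not_empty)
  moreover have "gamma0 \<gamma> a \<omega> \<ge> \<delta>" for a \<omega>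
    using \<delta>[of \<omega> "\<lambda>_. a"] by (simp add: gamma0_def cyl_def)
  ultimately show ?thesis by blast
qed

lemma kernel_site: "measure (\<gamma> {x} \<omega>) {\<omega>'. \<omega>' x = a} = gamma0 \<gamma> a (shift x \<omega>)"
proof -
  \<comment> \<open>\<open>trans_inv_spec\<close> speaks of images under \<open>shift x\<close>, so
    surjectivity is needed; \<open>shift (- x)\<close> supplies the preimage.\<close>
  have "{\<omega>'. \<omega>' 0 = a} \<subseteq> shift x ` {\<omega>'. \<omega>' x = a}"
  proof
    fix \<omega>' :: "(int, 'd) vec \<Rightarrow> 'e" assume "\<omega>' \<in> {\<omega>'. \<omega>' 0 = a}"
    then show "\<omega>' \<in> shift x ` {\<omega>'. \<omega>' x = a}"
      by (intro image_eqI[of _ _ "shift (- x) \<omega>'"]) (auto simp: shift_def)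
  qed
  then have "shift x ` {\<omega>'. \<omega>' x = a} = {\<omega>'. \<omega>' 0 = a}"
    by (auto simp: shift_def)
  moreover have "measure (\<gamma> ((\<lambda>y. y + x) ` {0}) \<omega>) {\<omega>'. \<omega>' x = a} = measure (\<gamma> {0} (shift x \<omega>)) (shift x ` {\<omega>'. \<omega>' x = a})"
    using coordinate_in_sets_Omega by (intro trans_inv[unfolded trans_inv_spec_def, rule_format]) simp_all
  ultimately show ?thesis by (simp add: gamma0_def)
qed

section \<open>Cylinder probabilities under a Gibbs measure\<close>

context
  fixes \<nu> :: "((int, 'd) vec \<Rightarrow> 'e) measure"
  assumes gibbs: "Gibbs \<gamma> \<nu>"
begin

interpretation \<nu>: config_prob \<nu>
  using gibbs is_prob_config_prob by (auto simp: Gibbs_def)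

lemma Gibbs_measure_Int:
  assumes "finite L" "A \<in> sets Omega" "B \<in> sets (Fsig (- L))"
  shows "measure \<nu> (A \<inter> B) = (\<integral>\<omega>. indicator B \<omega> * measure (\<gamma> L \<omega>) A \<partial>\<nu>)"
  using gibbs assms by (simp add: Gibbs_def set_lebesgue_integral_def)

text \<open>The nonnullness bound is integrated against \<open>\<nu>\<close>, using the DLR equation
  with the whole space as exterior event. The empty window is separate because
  \<open>nonnull\<close> speaks of nonempty ones.\<close>

lemma Gibbs_cyl_pos:
  assumes "finite L"
  shows "measure \<nu> (cyl L \<sigma>) > 0"
proof (cases "L = {}")
  case True
  then show ?thesis using \<nu>.prob_space by (simp add: cyl_def)
next
  case False
  with assms nonnull obtain a where a: "a > 0" "\<And>\<eta>. a < measure (\<gamma> L \<eta>) (cyl L \<sigma>)"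
    unfolding nonnull_def by metis
  have meas: "(\<lambda>\<omega>. measure (\<gamma> L \<omega>) (cyl L \<sigma>)) \<in> borel_measurable \<nu>"
    using borel_measurable_Fsig_Omega[OF borel_measurable_kernel_Fsig[OF assms]] assms
    by (simp add: \<nu>.sets_eq cong: measurable_cong_sets)
  have le1: "measure (\<gamma> L \<omega>) A \<le> 1" for A \<omega>
    using is_prob_kernel[OF assms, of \<omega>] by (auto simp: is_prob_def intro: prob_space.prob_le_1)
  have "a = (\<integral>\<omega>. a \<partial>\<nu>)" using \<nu>.prob_space by simp
  also have "\<dots> \<le> (\<integral>\<omega>. measure (\<gamma> L \<omega>) (cyl L \<sigma>) \<partial>\<nu>)"
    using a(2) le1 meas
    by (intro integral_mono) (auto intro: less_imp_le \<nu>.integrable_const_bound[of _ 1])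
  also have "\<dots> = measure \<nu> (cyl L \<sigma>)"
    using Gibbs_measure_Int[OF assms _ sets.top, of "cyl L \<sigma>"] assms by simp
  finally show ?thesis using a(1) by simp
qed

lemma Gibbs_cyl_site:
  assumes "finite L" "x \<in> L"
  shows "measure \<nu> (cyl L (\<xi>(x := a))) =
    (\<integral>\<omega>. indicator (cyl (L - {x}) \<xi>) \<omega> * gamma0 \<gamma> a (shift x \<omega>) \<partial>\<nu>)"
proof -
  have "cyl L (\<xi>(x := a)) = {\<omega>. \<omega> x = a} \<inter> cyl (L - {x}) \<xi>"
    using assms(2) by (auto simp: cyl_def)
  then show ?thesis
    using Gibbs_measure_Int[of "{x}" "{\<omega>. \<omega> x = a}" "cyl (L - {x}) \<xi>"] assms
    by (simp add: coordinate_in_sets_Omega kernel_site cyl_in_sets_Fsig Diff_eq)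
qed

text \<open>By \<open>Gibbs_cyl_site\<close> the quotient is the \<open>\<nu>\<close>-average over
  the cylinder on \<open>L - {x}\<close> of the single-site kernel seen from \<open>x\<close>, so
  bounds valid on that cylinder pass to it.\<close>

lemma Gibbs_cyl_site_bounds:
  assumes L: "finite L" "x \<in> L"
    and bounds: "\<And>\<omega>. \<omega> \<in> cyl (L - {x}) \<xi> \<Longrightarrow> l \<le> gamma0 \<gamma> a (shift x \<omega>) \<and> gamma0 \<gamma> a (shift x \<omega>) \<le> u"
  shows "l \<le> measure \<nu> (cyl L (\<xi>(x := a))) / measure \<nu> (cyl (L - {x}) \<xi>)"
    and "measure \<nu> (cyl L (\<xi>(x := a))) / measure \<nu> (cyl (L - {x}) \<xi>) \<le> u"
proof -
  let ?C = "cyl (L - {x}) \<xi>"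
  have C: "?C \<in> sets \<nu>" using L by simp
  have pos: "measure \<nu> ?C > 0" using L by (intro Gibbs_cyl_pos) simp
  have int_const: "integrable \<nu> (\<lambda>\<omega>. indicator ?C \<omega> * r)" for r :: real
    using C by (intro integrable_mult_left integrable_real_indicator) (auto simp: \<nu>.emeasure_eq_measure)
  have [measurable]: "(\<lambda>\<omega>. gamma0 \<gamma> a (shift x \<omega>)) \<in> borel_measurable \<nu>"
    using measurable_compose[OF measurable_shift borel_measurable_gamma0]
    by (simp add: \<nu>.sets_eq cong: measurable_cong_sets)
  have int: "integrable \<nu> (\<lambda>\<omega>. indicator ?C \<omega> * gamma0 \<gamma> a (shift x \<omega>))"
  proof (rule \<nu>.integrable_const_bound[of _ 1])
    show "AE \<omega> in \<nu>. norm (indicator ?C \<omega> * gamma0 \<gamma> a (shift x \<omega>)) \<le> 1"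
      by (auto simp: indicator_def gamma0_le_1 gamma0_nonneg)
    show "(\<lambda>\<omega>. indicator ?C \<omega> * gamma0 \<gamma> a (shift x \<omega>)) \<in> borel_measurable \<nu>"
      using C by measurable
  qed
  have const: "(\<integral>\<omega>. indicator ?C \<omega> * r \<partial>\<nu>) = r * measure \<nu> ?C" for r :: real
    using C by simp
  have "l * measure \<nu> ?C \<le> measure \<nu> (cyl L (\<xi>(x := a)))"
    unfolding Gibbs_cyl_site[OF L] const[symmetric] using bounds
    by (intro integral_mono int int_const) (auto simp: indicator_def)
  then show "l \<le> measure \<nu> (cyl L (\<xi>(x := a))) / measure \<nu> ?C"
    using pos by (simp add: pos_le_divide_eq)
  have "measure \<nu> (cyl L (\<xi>(x := a))) \<le> u * measure \<nu> ?C"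
    unfolding Gibbs_cyl_site[OF L] const[symmetric] using bounds
    by (intro integral_mono int int_const) (auto simp: indicator_def)
  then show "measure \<nu> (cyl L (\<xi>(x := a))) / measure \<nu> ?C \<le> u"
    using pos by (simp add: pos_divide_le_eq)
qed

text \<open>Dividing both probabilities by that of the cylinder on \<open>L - {x}\<close> leaves the
  difference of logarithms unchanged and places both quotients between \<open>\<delta>\<close> and
  1.\<close>

lemma Gibbs_cyl_flip_bounded:
  assumes \<delta>: "\<delta> > 0" "\<And>a \<omega>. gamma0 \<gamma> a \<omega> \<ge> \<delta>" and L: "finite L" "x \<in> L"
  shows "\<bar>ln (measure \<nu> (cyl L (\<xi>(x := a)))) - ln (measure \<nu> (cyl L (\<xi>(x := b))))\<bar> \<le> - ln \<delta>"
proof -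
  let ?q = "\<lambda>a. measure \<nu> (cyl L (\<xi>(x := a))) / measure \<nu> (cyl (L - {x}) \<xi>)"
  have "measure \<nu> (cyl (L - {x}) \<xi>) \<noteq> 0" "\<And>a. measure \<nu> (cyl L (\<xi>(x := a))) \<noteq> 0"
    using L by (auto intro!: Gibbs_cyl_pos[THEN less_imp_neq, THEN not_sym])
  then have eq: "ln (measure \<nu> (cyl L (\<xi>(x := a)))) - ln (measure \<nu> (cyl L (\<xi>(x := b)))) = ln (?q a) - ln (?q b)"
    by (simp add: ln_div)
  have q: "\<delta> \<le> ?q a" "?q a \<le> 1" for a
    using Gibbs_cyl_site_bounds[OF L, of \<xi> \<delta> a 1] \<delta>(2) gamma0_le_1 by auto
  have "ln \<delta> \<le> ln (?q a)" "ln (?q a) \<le> 0" for a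
    using q[of a] \<delta>(1) by (auto simp: ln_le_zero_iff intro: ln_mono)
  from this[of a] this[of b] show ?thesis unfolding eq by linarith
qed

text \<open>Each of the two conditional probabilities is an average of kernel values within
  \<open>\<epsilon>\<close> of the one at \<open>\<zeta>\<close>, and \<open>ln\<close> has slope at
  most \<open>1 / \<delta>\<close> there. The factor 2 accounts for the two spins.\<close>

lemma Gibbs_cyl_flip_approx:
  assumes \<delta>: "\<delta> > 0" "\<And>a \<omega>. gamma0 \<gamma> a \<omega> \<ge> \<delta>" and L: "finite L" "x \<in> L"
    and near: "\<And>a \<omega>. \<omega> \<in> cyl (L - {x}) \<xi> \<Longrightarrow> \<bar>gamma0 \<gamma> a (shift x \<omega>) - gamma0 \<gamma> a \<zeta>\<bar> \<le> \<epsilon>"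
  shows "\<bar>ln (measure \<nu> (cyl L (\<xi>(x := a)))) - ln (measure \<nu> (cyl L (\<xi>(x := b))))
    - ln (gamma0 \<gamma> a \<zeta> / gamma0 \<gamma> b \<zeta>)\<bar> \<le> 2 * \<epsilon> / \<delta>"
proof -
  let ?q = "\<lambda>a. measure \<nu> (cyl L (\<xi>(x := a))) / measure \<nu> (cyl (L - {x}) \<xi>)"
  have "measure \<nu> (cyl (L - {x}) \<xi>) \<noteq> 0" "\<And>a. measure \<nu> (cyl L (\<xi>(x := a))) \<noteq> 0"
    using L by (auto intro!: Gibbs_cyl_pos[THEN less_imp_neq, THEN not_sym])
  then have eq: "ln (measure \<nu> (cyl L (\<xi>(x := a)))) - ln (measure \<nu> (cyl L (\<xi>(x := b)))) = ln (?q a) - ln (?q b)"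
    by (simp add: ln_div)
  have "gamma0 \<gamma> a \<zeta> \<noteq> 0" for a using \<delta> by (metis not_le)
  then have ln_odds: "ln (gamma0 \<gamma> a \<zeta> / gamma0 \<gamma> b \<zeta>) = ln (gamma0 \<gamma> a \<zeta>) - ln (gamma0 \<gamma> b \<zeta>)"
    by (simp add: ln_div)
  have "\<bar>ln (?q a) - ln (gamma0 \<gamma> a \<zeta>)\<bar> \<le> \<epsilon> / \<delta>" for a
  proof -
    have "\<delta> \<le> ?q a"
      using Gibbs_cyl_site_bounds(1)[OF L, of \<xi> \<delta> a 1] \<delta>(2) gamma0_le_1 by auto
    then have "\<bar>ln (?q a) - ln (gamma0 \<gamma> a \<zeta>)\<bar> \<le> \<bar>?q a - gamma0 \<gamma> a \<zeta>\<bar> / \<delta>"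
      using \<delta> by (intro abs_ln_diff_le) auto
    also have "gamma0 \<gamma> a \<zeta> - \<epsilon> \<le> gamma0 \<gamma> a (shift x \<omega>) \<and> gamma0 \<gamma> a (shift x \<omega>) \<le> gamma0 \<gamma> a \<zeta> + \<epsilon>"
      if "\<omega> \<in> cyl (L - {x}) \<xi>" for \<omega>
      using near[OF that, of a] by linarith
    from Gibbs_cyl_site_bounds[where \<xi> = \<xi>, OF L this] have "\<bar>?q a - gamma0 \<gamma> a \<zeta>\<bar> / \<delta> \<le> \<epsilon> / \<delta>"
      using \<delta>(1) by (intro divide_right_mono) (auto simp: abs_le_iff)
    finally show ?thesis .
  qed
  from this[of a] this[of b] have "\<bar>(ln (?q a) - ln (?q b)) - (ln (gamma0 \<gamma> a \<zeta>) - ln (gamma0 \<gamma> b \<zeta>))\<bar> \<le> \<epsilon> / \<delta> + \<epsilon> / \<delta>"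
    by linarith
  then show ?thesis unfolding eq ln_odds by simp
qed

end

text \<open>The comparison is between two points of the cylinder rather than with \<open>plus_ext pl \<sigma>\<close> itself, so
  that the event depends on finitely many coordinates and is therefore measurable.\<close>
definition oscillating :: "'e \<Rightarrow> real \<Rightarrow> nat \<Rightarrow> ((int, 'd) vec \<Rightarrow> 'e) set" where
  "oscillating pl \<epsilon> k = {\<sigma>. \<exists>a. \<exists>\<omega>\<in>cyl (box k) (plus_ext pl \<sigma>). \<exists>\<omega>'\<in>cyl (box k) (plus_ext pl \<sigma>).
     \<epsilon> < \<bar>gamma0 \<gamma> a \<omega> - gamma0 \<gamma> a \<omega>'\<bar>}"

lemma oscillating_in_sets: "oscillating pl \<epsilon> k \<in> sets Omega"
proof -
  have "determined_by (box k) (\<lambda>\<sigma>. \<sigma> \<in> oscillating pl \<epsilon> k)"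
  proof (rule determined_byI)
    fix \<sigma> \<sigma>' :: "(int, 'd) vec \<Rightarrow> 'e" assume "\<And>x. x \<in> box k \<Longrightarrow> \<sigma> x = \<sigma>' x"
    then have "cyl (box k) (plus_ext pl \<sigma>) = cyl (box k) (plus_ext pl \<sigma>')"
      by (intro cyl_cong) (simp add: plus_ext_def)
    then show "(\<sigma> \<in> oscillating pl \<epsilon> k) = (\<sigma>' \<in> oscillating pl \<epsilon> k)"
      by (simp add: oscillating_def)
  qed
  from vimage_determined_by_in_sets[OF finite_box this, of "{True}"]
  show ?thesis by (simp add: vimage_def)
qed

lemma decseq_oscillating: "decseq (oscillating pl \<epsilon>)"
proof (rule decseq_SucI)
  fix k
  have "cyl (box (Suc k)) \<sigma> \<subseteq> cyl (box k) \<sigma>" for \<sigma> :: "(int, 'd) vec \<Rightarrow> 'e"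
    using box_mono[of k "Suc k"] by (fastforce simp: cyl_def)
  then show "oscillating pl \<epsilon> (Suc k) \<subseteq> oscillating pl \<epsilon> k"
    unfolding oscillating_def by blast
qed

text \<open>Continuity at the plus extension, applied to the indicator of spin \<open>a\<close> at
  the origin, gives a finite window for each \<open>a\<close>. Since \<open>E\<close> is finite, one
  box contains all windows, and two points of its cylinder are each within
  \<open>\<epsilon> / 2\<close> of the centre value.\<close>

lemma eventually_not_oscillating:
  assumes "\<sigma> \<in> Omega_le0 pl \<gamma>" "\<epsilon> > 0"
  shows "\<exists>k. \<sigma> \<notin> oscillating pl \<epsilon> k"
proof -
  let ?\<eta> = "plus_ext pl \<sigma>"
  have "\<exists>D. finite D \<and> (\<forall>\<omega>\<in>cyl D ?\<eta>. \<bar>gamma0 \<gamma> a \<omega> - gamma0 \<gamma> a ?\<eta>\<bar> < \<epsilon> / 2)" for a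
  proof -
    let ?f = "indicator {\<omega> :: (int, 'd) vec \<Rightarrow> 'e. \<omega> 0 = a} :: _ \<Rightarrow> real"
    have "{\<omega> :: (int, 'd) vec \<Rightarrow> 'e. \<omega> 0 = a} \<in> sets (Fsig {0})"
      unfolding sets_Fsig by (intro sigma_sets.Basic) auto
    then have "local_fn ?f" unfolding local_fn_def by (intro exI[of _ "{0}"]) auto
    moreover have "cont_point \<gamma> ?\<eta>" using assms(1) by (simp add: Omega_le0_def)
    ultimately obtain U where U: "openin Ptop U" "?\<eta> \<in> U"
      "\<forall>\<omega>'\<in>U. \<bar>(\<integral>\<xi>. ?f \<xi> \<partial>(\<gamma> {0} \<omega>')) - (\<integral>\<xi>. ?f \<xi> \<partial>(\<gamma> {0} ?\<eta>))\<bar> < \<epsilon> / 2"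
      unfolding cont_point_def using assms(2) half_gt_zero by (metis finite.emptyI finite_insert)
    have "(\<integral>\<xi>. ?f \<xi> \<partial>(\<gamma> {0} \<omega>)) = gamma0 \<gamma> a \<omega>" for \<omega>
    proof -
      interpret config_prob "\<gamma> {0} \<omega>"
        using is_prob_kernel[of "{0}" \<omega>] by (simp add: is_prob_config_prob)
      show ?thesis
        by (simp add: gamma0_def sets_eq coordinate_in_sets_Omega)
    qed
    with U(3) openin_Ptop_cyl[OF U(1,2)] show ?thesis by (metis subsetD)
  qed
  then obtain D where D: "\<And>a. finite (D a)"
    "\<And>a \<omega>. \<omega> \<in> cyl (D a) ?\<eta> \<Longrightarrow> \<bar>gamma0 \<gamma> a \<omega> - gamma0 \<gamma> a ?\<eta>\<bar> < \<epsilon> / 2"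
    by metis
  obtain k where k: "(\<Union>a. D a) \<subseteq> box k"
    using finite_subset_box[of "\<Union>a. D a"] D(1) by auto
  have "\<bar>gamma0 \<gamma> a \<omega> - gamma0 \<gamma> a ?\<eta>\<bar> < \<epsilon> / 2" if "\<omega> \<in> cyl (box k) ?\<eta>" for a \<omega>
    using that k by (intro D(2)) (auto simp: cyl_def)
  then have "\<sigma> \<notin> oscillating pl \<epsilon> k"
    unfolding oscillating_def by (smt (verit) field_sum_of_halves mem_Collect_eq)
  then show ?thesis by blast
qed

text \<open>Continuity from above: the intersection of the decreasing events misses
  \<open>Omega_le0 pl \<gamma>\<close>, whose complement is null by Condition C1.\<close>

lemma measure_oscillating_tendsto_0:
  assumes "is_prob \<mu>" "Omega_le0 pl \<gamma> \<in> sets \<mu>" "measure \<mu> (Omega_le0 pl \<gamma>) = 1" "\<epsilon> > 0"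
  shows "(\<lambda>k. measure \<mu> (oscillating pl \<epsilon> k)) \<longlonglongrightarrow> 0"
proof -
  interpret config_prob \<mu> using assms(1) by (rule is_prob_config_prob)
  have "(\<lambda>k. measure \<mu> (oscillating pl \<epsilon> k)) \<longlonglongrightarrow> measure \<mu> (\<Inter>k. oscillating pl \<epsilon> k)"
    by (rule finite_Lim_measure_decseq) (auto simp: sets_eq oscillating_in_sets decseq_oscillating)
  moreover have "measure \<mu> (\<Inter>k. oscillating pl \<epsilon> k) \<le> measure \<mu> (space \<mu> - Omega_le0 pl \<gamma>)"
    using eventually_not_oscillating[OF _ assms(4)] sets.compl_sets[OF assms(2)]
    by (intro finite_measure_mono) auto
  ultimately show ?thesis
    using prob_compl[OF assms(2)] assms(3) by (simp add: measure_le_0_iff)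
qed

lemma log_odds_bounded:
  assumes "\<delta> > 0" "\<And>a \<omega>. gamma0 \<gamma> a \<omega> \<ge> \<delta>"
  shows "\<bar>ln (gamma0 \<gamma> a \<omega> / gamma0 \<gamma> b \<omega>)\<bar> \<le> - ln \<delta>"
proof -
  have pos: "gamma0 \<gamma> a \<omega> \<noteq> 0" for a using assms by (metis not_le)
  have "ln \<delta> \<le> ln (gamma0 \<gamma> a \<omega>)" "ln (gamma0 \<gamma> a \<omega>) \<le> 0" for a
    using assms(1) assms(2)[of a \<omega>] gamma0_le_1[of a \<omega>] by (auto intro: ln_mono)
  from this[of a] this[of b] show ?thesis by (simp add: ln_div pos)
qed

lemma borel_measurable_log_odds:
  "(\<lambda>\<sigma>. ln (gamma0 \<gamma> (plus_ext pl \<sigma> 0) (plus_ext pl \<sigma>) / gamma0 \<gamma> pl (plus_ext pl \<sigma>))) \<in> borel_measurable Omega"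
proof -
  have ext: "plus_ext pl \<in> (Omega :: ((int, 'd) vec \<Rightarrow> 'e) measure) \<rightarrow>\<^sub>M Omega"
  proof -
    have "(\<lambda>\<sigma>. plus_ext pl \<sigma> x) \<in> Omega \<rightarrow>\<^sub>M count_space UNIV" for x :: "(int, 'd) vec"
      by (cases "lex_le x 0") (simp_all add: plus_ext_def)
    then show ?thesis
      unfolding Omega_def by (intro measurable_PiM_single') (auto simp: space_PiM)
  qed
  have [measurable]: "(\<lambda>\<sigma>. gamma0 \<gamma> a (plus_ext pl \<sigma>)) \<in> borel_measurable Omega" for a
    using measurable_compose[OF ext borel_measurable_gamma0] .
  have "(\<lambda>\<sigma> :: (int, 'd) vec \<Rightarrow> 'e. plus_ext pl \<sigma> 0) \<in> Omega \<rightarrow>\<^sub>M count_space UNIV"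
    using measurable_compose[OF ext measurable_coordinate] .
  \<comment> \<open>The spin argument itself varies with \<open>\<sigma>\<close>, but takes only
    finitely many values, so the function is pieced together from measurable ones.\<close>
  then have [measurable]: "(\<lambda>\<sigma>. gamma0 \<gamma> (plus_ext pl \<sigma> 0) (plus_ext pl \<sigma>)) \<in> borel_measurable Omega"
    by (rule measurable_compose_countable'[where f = "\<lambda>a \<sigma>. gamma0 \<gamma> a (plus_ext pl \<sigma>)", rotated])
       (auto intro: countable_finite)
  show ?thesis by measurable
qed

text \<open>Turning the plus configuration into \<open>\<sigma>\<close> site by site in lexicographic order, the
  step at \<open>x\<close> changes \<open>ln \<nu>\<close> by nearly the log odds of the single-site kernel seen from \<open>x\<close>:
  at that stage the configuration is the plus extension of the past of \<open>\<sigma>\<close> as far as the box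
  reaches.\<close>
lemma specific_log_likelihood_tendsto:
  fixes \<mu> \<nu> :: "((int, 'd) vec \<Rightarrow> 'e) measure" and pl :: 'e
  assumes inv_mu: "inv_measure \<mu>" and gibbs: "Gibbs \<gamma> \<nu>"
    and C1: "Omega_le0 pl \<gamma> \<in> sets \<mu>" "measure \<mu> (Omega_le0 pl \<gamma>) = 1"
  shows "(\<lambda>n. ((\<integral>\<sigma>. ln (measure \<nu> (cyl (box n) \<sigma>)) \<partial>\<mu>) - ln (measure \<nu> (cyl (box n) (\<lambda>_. pl))))
      / real (card (box n :: (int, 'd) vec set)))
    \<longlonglongrightarrow> (\<integral>\<sigma>. ln (gamma0 \<gamma> (plus_ext pl \<sigma> 0) (plus_ext pl \<sigma>) / gamma0 \<gamma> pl (plus_ext pl \<sigma>)) \<partial>\<mu>)"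
proof -
  interpret inv_config_prob \<mu> using inv_mu by (rule inv_measure_inv_config_prob)
  interpret \<nu>: config_prob \<nu> using gibbs is_prob_config_prob by (auto simp: Gibbs_def)
  obtain \<delta> where \<delta>: "\<delta> > 0" "\<And>a \<omega>. gamma0 \<gamma> a \<omega> \<ge> \<delta>" using gamma0_lower_bound by auto
  define K where "K = - ln \<delta>"
  define G where "G \<sigma> = ln (gamma0 \<gamma> (plus_ext pl \<sigma> 0) (plus_ext pl \<sigma>) / gamma0 \<gamma> pl (plus_ext pl \<sigma>))" for \<sigma>
  define mix where "mix T \<sigma> y = (if y \<in> T then \<sigma> y else pl)" for T and \<sigma> :: "(int, 'd) vec \<Rightarrow> 'e" and y
  define \<Phi> where "\<Phi> n T \<sigma> = ln (measure \<nu> (cyl (box n) (mix T \<sigma>)))" for n T \<sigma>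
  define \<Delta> where "\<Delta> n x \<sigma> = \<Phi> n (insert x (lex_past (box n) x)) \<sigma> - \<Phi> n (lex_past (box n) x) \<sigma>" for n x \<sigma>
  have G_meas: "G \<in> borel_measurable \<mu>"
    unfolding G_def using borel_measurable_log_odds by (simp add: sets_eq cong: measurable_cong_sets)
  have G_bound: "\<bar>G \<sigma>\<bar> \<le> K" for \<sigma>
    unfolding G_def K_def by (rule log_odds_bounded[OF \<delta>])
  have shift_meas: "(\<lambda>\<sigma>. G (shift x \<sigma>)) \<in> borel_measurable \<mu>" for x
    using measurable_compose[OF measurable_shift' G_meas] .
  have G_int: "integrable \<mu> (\<lambda>\<sigma>. G (shift x \<sigma>))" for x
    using G_bound by (intro integrable_const_bound[of _ K] shift_meas) auto
  have \<Phi>_int: "integrable \<mu> (\<Phi> n T)" for n T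
    unfolding \<Phi>_def
    by (intro integrable_determined_by[OF finite_box[of n]] determined_byI arg_cong[where f = ln]
        arg_cong[where f = "measure \<nu>"] cyl_cong) (auto simp: mix_def)
  have \<Delta>_int: "integrable \<mu> (\<Delta> n x)" for n x
    unfolding \<Delta>_def by (intro Bochner_Integration.integrable_diff \<Phi>_int)
  \<comment> \<open>No site belongs to its own strict past, so before the step the spin at
    \<open>x\<close> is \<open>pl\<close>. Both terms are thus updates of one mixed configuration at
    \<open>x\<close>.\<close>
  have flip: "\<Delta> n x \<sigma> = ln (measure \<nu> (cyl (box n) ((mix (lex_past (box n) x) \<sigma>)(x := \<sigma> x))))
      - ln (measure \<nu> (cyl (box n) ((mix (lex_past (box n) x) \<sigma>)(x := pl))))" for n x \<sigma>
  proof -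
    have "mix (insert x (lex_past (box n) x)) \<sigma> = (mix (lex_past (box n) x) \<sigma>)(x := \<sigma> x)"
      "mix (lex_past (box n) x) \<sigma> = (mix (lex_past (box n) x) \<sigma>)(x := pl)"
      by (auto simp: mix_def lex_past_def fun_eq_iff)
    then show ?thesis unfolding \<Delta>_def \<Phi>_def by simp
  qed
  have \<Delta>_bound: "\<bar>\<Delta> n x \<sigma>\<bar> \<le> K" if "x \<in> box n" for n x \<sigma>
    unfolding flip K_def by (rule Gibbs_cyl_flip_bounded[OF gibbs \<delta> finite_box that])
  have K: "K \<ge> 0" using G_bound[of undefined] by linarith
  have \<Delta>_near: "\<bar>\<Delta> n x \<sigma> - G (shift x \<sigma>)\<bar> \<le> 2 * \<epsilon> / \<delta>"
    if x: "x \<in> box n" "\<forall>y\<in>box k. x + y \<in> box n" and good: "shift x \<sigma> \<notin> oscillating pl \<epsilon> k" for n x \<sigma> k \<epsilon>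
  proof -
    let ?\<zeta> = "plus_ext pl (shift x \<sigma>)"
    have "\<bar>gamma0 \<gamma> a (shift x \<omega>) - gamma0 \<gamma> a ?\<zeta>\<bar> \<le> \<epsilon>"
      if \<omega>: "\<omega> \<in> cyl (box n - {x}) (mix (lex_past (box n) x) \<sigma>)" for a \<omega>
    proof -
      \<comment> \<open>The cylinder leaves the spin of \<open>\<omega>\<close> at \<open>x\<close>
        free, so the shifted configuration may differ from \<open>?\<zeta>\<close> at the origin.
        Resetting that spin puts it into the cylinder around \<open>?\<zeta>\<close>, and
        \<open>gamma0\<close> does not see the change.\<close>
      let ?\<omega>' = "(shift x \<omega>)(0 := ?\<zeta> 0)"
      have "shift x \<omega> y = ?\<zeta> y" if "y \<in> box k" "y \<noteq> 0" for y
        using \<omega> x(2) that by (auto simp: cyl_def shift_def plus_ext_def mix_def lex_past_def lex_le_add_left)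
      then have "?\<omega>' \<in> cyl (box k) ?\<zeta>" by (auto simp: cyl_def)
      moreover have "?\<zeta> \<in> cyl (box k) ?\<zeta>" by (simp add: cyl_def)
      moreover have "\<forall>\<omega>\<in>cyl (box k) ?\<zeta>. \<forall>\<omega>'\<in>cyl (box k) ?\<zeta>. \<bar>gamma0 \<gamma> a \<omega> - gamma0 \<gamma> a \<omega>'\<bar> \<le> \<epsilon>"
        using good by (simp add: oscillating_def not_less)
      ultimately have "\<bar>gamma0 \<gamma> a ?\<omega>' - gamma0 \<gamma> a ?\<zeta>\<bar> \<le> \<epsilon>" by blast
      moreover have "gamma0 \<gamma> a ?\<omega>' = gamma0 \<gamma> a (shift x \<omega>)"
        by (rule determined_byD[OF determined_by_gamma0]) auto
      ultimately show ?thesis by simp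
    qed
    from Gibbs_cyl_flip_approx[where \<xi> = "mix (lex_past (box n) x) \<sigma>" and a = "\<sigma> x" and b = pl,
        OF gibbs \<delta> finite_box x(1) this]
    show ?thesis unfolding flip G_def by (simp add: plus_ext_def shift_def lex_le_def)
  qed
  \<comment> \<open>Invariance of \<open>\<mu>\<close> allows recentring the integrand at
    \<open>x\<close>, which makes the comparison with the step at \<open>x\<close>
    pointwise.\<close>
  have diff_eq: "(\<integral>\<sigma>. \<Delta> n x \<sigma> \<partial>\<mu>) - (\<integral>\<sigma>. G \<sigma> \<partial>\<mu>) = (\<integral>\<sigma>. \<Delta> n x \<sigma> - G (shift x \<sigma>) \<partial>\<mu>)" for n x
    using integral_shift[OF G_meas, of x] \<Delta>_int G_int by simp
  have "(\<lambda>n. (\<Sum>x\<in>box n. \<integral>\<sigma>. \<Delta> n x \<sigma> \<partial>\<mu>) / real (card (box n :: (int, 'd) vec set))) \<longlonglongrightarrow> (\<integral>\<sigma>. G \<sigma> \<partial>\<mu>)"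
  proof (rule box_average_tendsto)
    fix n and x :: "(int, 'd) vec" assume x: "x \<in> box n"
    have "\<bar>\<integral>\<sigma>. \<Delta> n x \<sigma> - G (shift x \<sigma>) \<partial>\<mu>\<bar> \<le> (\<integral>\<sigma>. \<bar>\<Delta> n x \<sigma> - G (shift x \<sigma>)\<bar> \<partial>\<mu>)"
      by (rule integral_abs_bound)
    also have "\<dots> \<le> (\<integral>\<sigma>. 2 * K \<partial>\<mu>)"
    proof (intro integral_mono integrable_abs Bochner_Integration.integrable_diff \<Delta>_int G_int)
      fix \<sigma> show "\<bar>\<Delta> n x \<sigma> - G (shift x \<sigma>)\<bar> \<le> 2 * K"
        using \<Delta>_bound[OF x, of \<sigma>] G_bound[of "shift x \<sigma>"] by linarith
    qed simp
    finally show "\<bar>(\<integral>\<sigma>. \<Delta> n x \<sigma> \<partial>\<mu>) - (\<integral>\<sigma>. G \<sigma> \<partial>\<mu>)\<bar> \<le> 2 * K"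
      using prob_space by (simp add: diff_eq)
  next
    fix \<epsilon> :: real assume \<epsilon>: "\<epsilon> > 0"
    define \<epsilon>' where "\<epsilon>' = \<epsilon> * \<delta> / 4"
    have \<epsilon>': "\<epsilon>' > 0" "2 * \<epsilon>' / \<delta> = \<epsilon> / 2" using \<epsilon> \<delta>(1) by (auto simp: \<epsilon>'_def)
    let ?B = "oscillating pl \<epsilon>'"
    have "is_prob \<mu>" using inv_mu by (simp add: inv_measure_def)
    from tendsto_mult[OF tendsto_const[of "2 * K"] measure_oscillating_tendsto_0[OF this C1 \<epsilon>'(1)]]
    have "(\<lambda>k. 2 * K * measure \<mu> (?B k)) \<longlonglongrightarrow> 0" by simp
    then have "eventually (\<lambda>k. 2 * K * measure \<mu> (?B k) < \<epsilon> / 2) sequentially"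
      using \<epsilon> by (intro order_tendstoD(2)) auto
    then obtain k where k: "2 * K * measure \<mu> (?B k) < \<epsilon> / 2"
      by (auto simp: eventually_sequentially)
    have B: "?B k \<in> sets \<mu>" by (simp add: sets_eq oscillating_in_sets)
    have ind_meas: "(\<lambda>\<sigma>. indicator (?B k) (shift x \<sigma>) :: real) \<in> borel_measurable \<mu>" for x
      using measurable_compose[OF measurable_shift' borel_measurable_indicator[OF B]] .
    have ind_int: "integrable \<mu> (\<lambda>\<sigma>. 2 * K * indicator (?B k) (shift x \<sigma>))" for x
      by (intro integrable_mult_right integrable_const_bound[of _ 1] ind_meas) (auto simp: indicator_def)
    have "\<bar>(\<integral>\<sigma>. \<Delta> n x \<sigma> \<partial>\<mu>) - (\<integral>\<sigma>. G \<sigma> \<partial>\<mu>)\<bar> \<le> \<epsilon>"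
      if x: "x \<in> box n" "\<forall>y\<in>box k. x + y \<in> box n" for n x
    proof -
      have "\<bar>\<integral>\<sigma>. \<Delta> n x \<sigma> - G (shift x \<sigma>) \<partial>\<mu>\<bar> \<le> (\<integral>\<sigma>. \<bar>\<Delta> n x \<sigma> - G (shift x \<sigma>)\<bar> \<partial>\<mu>)"
        by (rule integral_abs_bound)
      \<comment> \<open>Off the oscillating event the choice of \<open>\<epsilon>'\<close> gives the
        error \<open>\<epsilon> / 2\<close>; on it both quantities are bounded by \<open>K\<close>.
        By invariance the event seen from \<open>x\<close> has the same probability for every
        \<open>x\<close>.\<close>
      also have "\<dots> \<le> (\<integral>\<sigma>. \<epsilon> / 2 + 2 * K * indicator (?B k) (shift x \<sigma>) \<partial>\<mu>)"
      proof (intro integral_mono integrable_abs Bochner_Integration.integrable_diff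
          Bochner_Integration.integrable_add \<Delta>_int G_int ind_int)
        fix \<sigma> show "\<bar>\<Delta> n x \<sigma> - G (shift x \<sigma>)\<bar> \<le> \<epsilon> / 2 + 2 * K * indicator (?B k) (shift x \<sigma>)"
        proof (cases "shift x \<sigma> \<in> ?B k")
          case True
          then show ?thesis
            using \<Delta>_bound[OF x(1), of \<sigma>] G_bound[of "shift x \<sigma>"] \<epsilon> by simp
        next
          case False
          then show ?thesis using \<Delta>_near[OF x False] \<epsilon>'(2) by simp
        qed
      qed simp
      also have "\<dots> = \<epsilon> / 2 + 2 * K * (\<integral>\<sigma>. indicator (?B k) (shift x \<sigma>) \<partial>\<mu>)"
        using ind_int[of x] prob_space by simp
      also have "(\<integral>\<sigma>. indicator (?B k) (shift x \<sigma>) \<partial>\<mu>) = measure \<mu> (?B k)"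
        using integral_shift[OF borel_measurable_indicator[OF B], of x] B by simp
      finally show ?thesis using k by (simp add: diff_eq)
    qed
    then show "\<exists>k. \<forall>n x. x \<in> box n \<longrightarrow> (\<forall>y\<in>box k. x + y \<in> box n) \<longrightarrow>
        \<bar>(\<integral>\<sigma>. \<Delta> n x \<sigma> \<partial>\<mu>) - (\<integral>\<sigma>. G \<sigma> \<partial>\<mu>)\<bar> \<le> \<epsilon>" by blast
  qed
  moreover have "(\<Sum>x\<in>box n. \<integral>\<sigma>. \<Delta> n x \<sigma> \<partial>\<mu>) =
      (\<integral>\<sigma>. ln (measure \<nu> (cyl (box n) \<sigma>)) \<partial>\<mu>) - ln (measure \<nu> (cyl (box n) (\<lambda>_. pl)))" for n
  proof -
    \<comment> \<open>Telescoping applies to the set function that sends \<open>T\<close> to the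
      mean of \<open>\<Phi> n T\<close>: the full box gives \<open>\<sigma>\<close>, the empty set
      the plus configuration.\<close>
    have "(\<Sum>x\<in>box n. \<integral>\<sigma>. \<Delta> n x \<sigma> \<partial>\<mu>) = (\<integral>\<sigma>. \<Phi> n (box n) \<sigma> \<partial>\<mu>) - (\<integral>\<sigma>. \<Phi> n {} \<sigma> \<partial>\<mu>)"
      unfolding \<Delta>_def using sum_lex_past_telescope[OF finite_box, of "\<lambda>T. \<integral>\<sigma>. \<Phi> n T \<sigma> \<partial>\<mu>" n] \<Phi>_int by simp
    moreover have "\<Phi> n (box n) \<sigma> = ln (measure \<nu> (cyl (box n) \<sigma>))" for \<sigma>
      unfolding \<Phi>_def by (intro arg_cong[where f = ln] arg_cong[where f = "measure \<nu>"] cyl_cong) (simp add: mix_def)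
    moreover have "\<Phi> n {} \<sigma> = ln (measure \<nu> (cyl (box n) (\<lambda>_. pl)))" for \<sigma>
      unfolding \<Phi>_def by (intro arg_cong[where f = ln] arg_cong[where f = "measure \<nu>"] cyl_cong) (simp add: mix_def)
    ultimately show ?thesis using prob_space by simp
  qed
  ultimately show ?thesis by (simp add: G_def)
qed

end

section \<open>The relative entropy density\<close>

text \<open>Since \<open>\<nu>\<close> charges every cylinder, the logarithm of the quotient splits
  wherever \<open>\<mu>\<close> has mass; elsewhere every term vanishes.\<close>

lemma (in config_prob) rel_ent_box_eq:
  assumes "finite L" "\<And>\<sigma>. measure \<nu> (cyl L \<sigma>) > 0"
  shows "rel_ent_box \<mu> \<nu> L = - ent_box \<mu> L - (\<integral>\<sigma>. ln (measure \<nu> (cyl L \<sigma>)) \<partial>\<mu>)"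
proof -
  have nz: "measure \<nu> (cyl L \<sigma>) \<noteq> 0" for \<sigma> using assms(2)[of \<sigma>] by simp
  have "determined_by L (\<lambda>\<sigma>. ln (measure \<nu> (cyl L \<sigma>)))"
    by (intro determined_byI arg_cong[where f = ln] arg_cong[where f = "measure \<nu>"] cyl_cong) auto
  then have "(\<integral>\<sigma>. ln (measure \<nu> (cyl L \<sigma>)) \<partial>\<mu>) = (\<Sum>\<tau>\<in>cfgs L. measure \<mu> (cyl L \<tau>) * ln (measure \<nu> (cyl L \<tau>)))"
    by (rule integral_determined_by[OF assms(1)])
  moreover have "measure \<mu> (cyl L \<tau>) * ln (measure \<mu> (cyl L \<tau>) / measure \<nu> (cyl L \<tau>)) =
      measure \<mu> (cyl L \<tau>) * ln (measure \<mu> (cyl L \<tau>)) - measure \<mu> (cyl L \<tau>) * ln (measure \<nu> (cyl L \<tau>))" for \<tau>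
    using nz by (cases "measure \<mu> (cyl L \<tau>) = 0") (auto simp: ln_div right_diff_distrib)
  ultimately show ?thesis
    by (simp add: rel_ent_box_def ent_box_def sum_subtractf)
qed

theorem theorem3p3:
  fixes \<gamma> :: "(int ^ ('d::{finite,linorder})) set \<Rightarrow> (int ^ ('d::{finite,linorder}) \<Rightarrow> ('e::finite)) \<Rightarrow> (int ^ ('d::{finite,linorder}) \<Rightarrow> ('e::finite)) measure"
    and pl :: "'e::finite"
    and \<mu> \<nu> :: "(int ^ ('d::{finite,linorder}) \<Rightarrow> ('e::finite)) measure"
  assumes "is_specification \<gamma>" and "nonnull \<gamma>" and "trans_inv_spec \<gamma>"
    and "Gibbs_inv \<gamma> \<nu>"
    and "inv_measure \<mu>"
    and C1: "Omega_le0 pl \<gamma> \<in> sets \<mu>" "measure \<mu> (Omega_le0 pl \<gamma>) = 1"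
  shows "(convergent (rel_ent_seq \<mu> \<nu>) \<longleftrightarrow> convergent (eplus_seq pl \<nu>))
    \<and> (convergent (eplus_seq pl \<nu>) \<longrightarrow>
         lim (rel_ent_seq \<mu> \<nu>) = - lim (ent_seq \<mu>) + lim (eplus_seq pl \<nu>)
           - (\<integral>\<sigma>. ln (gamma0 \<gamma> (plus_ext pl \<sigma> 0) (plus_ext pl \<sigma>) / gamma0 \<gamma> pl (plus_ext pl \<sigma>)) \<partial>\<mu>))
    \<and> (Gibbs_inv \<gamma> \<mu> \<and> convergent (eplus_seq pl \<nu>) \<longrightarrow>
         (\<lambda>n. ln (measure \<mu> (cyl (box n) (\<lambda>_. pl)) / measure \<nu> (cyl (box n) (\<lambda>_. pl)))
                / real (card (box n :: (int ^ ('d::{finite,linorder})) set)))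
           \<longlonglongrightarrow> lim (rel_ent_seq \<mu> \<nu>))"
proof -
  interpret inv_specification \<gamma> by (unfold_locales; fact)
  interpret inv_config_prob \<mu> using assms(5) by (rule inv_measure_inv_config_prob)
  have gibbs: "Gibbs \<gamma> \<nu>" using assms(4) by (simp add: Gibbs_inv_def)
  define N where "N n = real (card (box n :: (int, 'd) vec set))" for n
  define g where "g = (\<integral>\<sigma>. ln (gamma0 \<gamma> (plus_ext pl \<sigma> 0) (plus_ext pl \<sigma>) / gamma0 \<gamma> pl (plus_ext pl \<sigma>)) \<partial>\<mu>)"
  define \<alpha> where "\<alpha> \<rho> n = ((\<integral>\<sigma>. ln (measure \<rho> (cyl (box n) \<sigma>)) \<partial>\<mu>) - ln (measure \<rho> (cyl (box n) (\<lambda>_. pl)))) / N n"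
    for \<rho> :: "((int, 'd) vec \<Rightarrow> 'e) measure" and n
  have \<alpha>: "\<alpha> \<rho> \<longlonglongrightarrow> g" if "Gibbs \<gamma> \<rho>" for \<rho>
    unfolding \<alpha>_def g_def N_def by (rule specific_log_likelihood_tendsto[OF assms(5) that C1])
  have ent: "ent_seq \<mu> \<longlonglongrightarrow> lim (ent_seq \<mu>)"
    using convergent_ent_seq by (simp add: convergent_LIMSEQ_iff)
  \<comment> \<open>An exact identity for each \<open>n\<close>. The entropy term and
    \<open>\<alpha> \<nu>\<close> converge, so the other two sequences converge or fail to converge
    together.\<close>
  have rel: "rel_ent_seq \<mu> \<nu> n = - ent_seq \<mu> n + eplus_seq pl \<nu> n - \<alpha> \<nu> n" for n
    unfolding rel_ent_seq_def ent_seq_def eplus_seq_def \<alpha>_def N_def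
    by (subst rel_ent_box_eq) (auto intro: Gibbs_cyl_pos[OF gibbs] simp: diff_divide_distrib)
  have lim: "rel_ent_seq \<mu> \<nu> \<longlonglongrightarrow> - lim (ent_seq \<mu>) + L - g" if "eplus_seq pl \<nu> \<longlonglongrightarrow> L" for L
    unfolding rel by (intro tendsto_intros ent that \<alpha>[OF gibbs])
  have iff: "convergent (rel_ent_seq \<mu> \<nu>) \<longleftrightarrow> convergent (eplus_seq pl \<nu>)"
  proof
    assume "convergent (rel_ent_seq \<mu> \<nu>)"
    then obtain L where "rel_ent_seq \<mu> \<nu> \<longlonglongrightarrow> L" by (auto simp: convergent_def)
    from tendsto_add[OF tendsto_add[OF this ent] \<alpha>[OF gibbs]]
    have "eplus_seq pl \<nu> \<longlonglongrightarrow> L + lim (ent_seq \<mu>) + g" by (simp add: rel)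
    then show "convergent (eplus_seq pl \<nu>)" by (rule convergentI)
  qed (auto simp: convergent_def dest: lim)
  have part2: "(\<lambda>n. ln (measure \<mu> (cyl (box n) (\<lambda>_. pl)) / measure \<nu> (cyl (box n) (\<lambda>_. pl))) / N n)
      \<longlonglongrightarrow> lim (rel_ent_seq \<mu> \<nu>)" if "Gibbs_inv \<gamma> \<mu>" "convergent (eplus_seq pl \<nu>)"
  proof -
    have gibbs': "Gibbs \<gamma> \<mu>" using that(1) by (simp add: Gibbs_inv_def)
    have nz: "measure \<mu> (cyl (box n) (\<lambda>_. pl)) \<noteq> 0" "measure \<nu> (cyl (box n) (\<lambda>_. pl)) \<noteq> 0" for n
      using Gibbs_cyl_pos[OF gibbs' finite_box] Gibbs_cyl_pos[OF gibbs finite_box] by (metis less_irrefl)+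
    have "rel_ent_seq \<mu> \<nu> \<longlonglongrightarrow> lim (rel_ent_seq \<mu> \<nu>)"
      using that(2) iff by (simp add: convergent_LIMSEQ_iff)
    \<comment> \<open>Both \<open>\<alpha> \<nu>\<close> and \<open>\<alpha> \<mu>\<close> tend to
      \<open>g\<close>, so this correction leaves the limit unchanged.\<close>
    from tendsto_diff[OF tendsto_add[OF this \<alpha>[OF gibbs]] \<alpha>[OF gibbs']]
    have "(\<lambda>n. rel_ent_seq \<mu> \<nu> n + \<alpha> \<nu> n - \<alpha> \<mu> n) \<longlonglongrightarrow> lim (rel_ent_seq \<mu> \<nu>)" by simp
    moreover have "rel_ent_seq \<mu> \<nu> n + \<alpha> \<nu> n - \<alpha> \<mu> n =
        ln (measure \<mu> (cyl (box n) (\<lambda>_. pl)) / measure \<nu> (cyl (box n) (\<lambda>_. pl))) / N n" for n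
    proof -
      \<comment> \<open>The mean log likelihood of \<open>\<mu>\<close> under itself is minus its
        entropy; hence the entropies cancel and only the two plus probabilities remain.\<close>
      have "\<alpha> \<mu> n = - ent_seq \<mu> n + eplus_seq pl \<mu> n"
        unfolding \<alpha>_def ent_seq_def eplus_seq_def N_def
        by (simp add: ent_box_eq H_def diff_divide_distrib)
      then show ?thesis
        unfolding rel by (simp add: eplus_seq_def N_def ln_div nz diff_divide_distrib)
    qed
    ultimately show ?thesis by simp
  qed
  show ?thesis
    using iff part2 limI[OF lim[of "lim (eplus_seq pl \<nu>)"]]
    unfolding N_def g_def[symmetric] by (auto simp: convergent_LIMSEQ_iff)
qed

end
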